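(* Let $\mathfrak{g}$ be a finite-dimensional Lie algebra over a field $\mathbb{K}$ of characteristic zero. Let $V$ and $W$ be two non-negative dg $\mathfrak{g}$-modules, and assume that $V$ and $W$ are dg lifts of $\mathfrak{g}$-modules $E$ and $F$, respectively. If $V$ is a resolution of $E$, then for every $\mathfrak{g}$-module morphism $\varphi\colon E\to F$ there exists a weak morphism $f\colon V\rightsquigarrow W$ of dg $\mathfrak{g}$-modules which is a dg lift of $\varphi$. Moreover, any two dg lifts of $\varphi$ are homotopic, i.e. the homotopy class $[f]$ is unique.
   Context: A dg $\mathfrak{g}$-module is a bounded cochain complex $(V^\bullet,d^V)$ in which each $V^i$ is a $\mathfrak{g}$-module and each differential is $\mathfrak{g}$-equivariant; it is non-negative if $V^i=0$ for $i<0$. Write $\Omega_{\mathfrak g}=\wedge^\bullet\mathfrak g^\vee$ and $\Omega_{\mathfrak g}(V)=\wedge^\bullet\mathfrak g^\vee\otimes V$, graded so that $\wedge^p\mathfrak g^\vee\otimes V^q$ has degree $p+q$, with total differential $d^V_{\mathrm{tot}}=d^V_{\mathrm{CE}}+d^V$, where $d^V_{\mathrm{CE}}$ is the Chevalley–Eilenberg differential of the $\mathfrak g$-module $\oplus_iV^i$ and $d^V(\omega\otimes v)=(-1)^p\omega\otimes d^Vv$ for $\omega\in\wedge^p\mathfrak g^\vee$. A weak morphism $f\colon V\rightsquigarrow W$ is a degree $0$, $\Omega_{\mathfrak g}$-linear map $f\colon\Omega_{\mathfrak g}(V)\to\Omega_{\mathfrak g}(W)$ with $f\circ d^V_{\mathrm{tot}}=d^W_{\mathrm{tot}}\circ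 f$; it is determined by components $f_k^l\colon V^k\to\wedge^l\mathfrak g^\vee\otimes W^{k-l}$. Two weak morphisms $f,f'\colon V\rightsquigarrow W$ are homotopic if there is a degree $-1$, $\Omega_{\mathfrak g}$-linear map $h\colon\Omega_{\mathfrak g}(V)\to\Omega_{\mathfrak g}(W)$ with $f'-f=d^W_{\mathrm{tot}}\circ h+h\circ d^V_{\mathrm{tot}}$. The $\mathfrak g$-module $\mathbf H^0(V)=\ker d^V_0/\mathrm{im}\,d^V_{-1}$, and for a weak morphism $f$, $\mathbf H^0(f)\colon\mathbf H^0(V)\to\mathbf H^0(W)$ is the $\mathfrak g$-module map induced by $f_0^0$. A dg $\mathfrak g$-module $V$ is a dg lift of a $\mathfrak g$-module $E$ if $V$ is non-negative and $E\cong\mathbf H^0(V)=\ker d^V_0$ as $\mathfrak g$-modules; it is a resolution of $E$ if moreover $\mathbf H^i(V)=0$ for all $i\ge1$. If $V,W$ are dg lifts of $E,F$ and $\varphi\colon E\to F$ is a $\mathfrak g$-module map, a dg lift of $\varphi$ is a weak morphism $f\colon V\rightsquigarrow W$ with $\mathbf H^0(f)=\varphi$ (under the identifications $E\cong\mathbf H^0(V)$, $F\cong\mathbf H^0(W)$). *)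

theory Defs
  imports Complex_Main "HOL-Combinatorics.Permutations"
begin

definition bilinear_br :: "('k::field \<Rightarrow> 'g::ab_group_add \<Rightarrow> 'g) \<Rightarrow> ('g \<Rightarrow> 'g \<Rightarrow> 'g) \<Rightarrow> bool" where
  "bilinear_br sG br \<longleftrightarrow>
     (\<forall>x y z. br (x + y) z = br x z + br y z) \<and>
     (\<forall>x y z. br x (y + z) = br x y + br x z) \<and>
     (\<forall>c x y. br (sG c x) y = sG c (br x y)) \<and>
     (\<forall>c x y. br x (sG c y) = sG c (br x y))"

definition lie_algebra :: "('k::field \<Rightarrow> 'g::ab_group_add \<Rightarrow> 'g) \<Rightarrow> ('g \<Rightarrow> 'g \<Rightarrow> 'g) \<Rightarrow> bool" where
  "lie_algebra sG br \<longleftrightarrow> vector_space sG \<and>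
     (\<exists>B. finite B \<and> module.span sG B = UNIV) \<and>
     bilinear_br sG br \<and>
     (\<forall>x. br x x = 0) \<and>
     (\<forall>x y z. br x (br y z) + br y (br z x) + br z (br x y) = 0)"

definition gmod :: "('k::field \<Rightarrow> 'g::ab_group_add \<Rightarrow> 'g) \<Rightarrow> ('g \<Rightarrow> 'g \<Rightarrow> 'g) \<Rightarrow>
    ('k \<Rightarrow> 'v::ab_group_add \<Rightarrow> 'v) \<Rightarrow> ('g \<Rightarrow> 'v \<Rightarrow> 'v) \<Rightarrow> 'v set \<Rightarrow> bool" where
  "gmod sG br sV rho M \<longleftrightarrow> vector_space sV \<and> module.subspace sV M \<and>
     (\<forall>x. \<forall>v\<in>M. rho x v \<in> M) \<and>
     (\<forall>x y. \<forall>v\<in>M. rho (x + y) v = rho x v + rho y v) \<and>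
     (\<forall>c x. \<forall>v\<in>M. rho (sG c x) v = sV c (rho x v)) \<and>
     (\<forall>x. \<forall>v\<in>M. \<forall>w\<in>M. rho x (v + w) = rho x v + rho x w) \<and>
     (\<forall>c x. \<forall>v\<in>M. rho x (sV c v) = sV c (rho x v)) \<and>
     (\<forall>x y. \<forall>v\<in>M. rho (br x y) v = rho x (rho y v) - rho y (rho x v))"

definition gmod_hom :: "('k::field \<Rightarrow> 'e::ab_group_add \<Rightarrow> 'e) \<Rightarrow> ('g \<Rightarrow> 'e \<Rightarrow> 'e) \<Rightarrow>
    ('k \<Rightarrow> 'f::ab_group_add \<Rightarrow> 'f) \<Rightarrow> ('g \<Rightarrow> 'f \<Rightarrow> 'f) \<Rightarrow> 'e set \<Rightarrow> ('e \<Rightarrow> 'f) \<Rightarrow> bool" where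
  "gmod_hom sE rhoE sF rhoF M phi \<longleftrightarrow>
     (\<forall>v\<in>M. \<forall>w\<in>M. phi (v + w) = phi v + phi w) \<and>
     (\<forall>c. \<forall>v\<in>M. phi (sE c v) = sF c (phi v)) \<and>
     (\<forall>x. \<forall>v\<in>M. phi (rhoE x v) = rhoF x (phi v))"

text \<open>The graded pieces V^i are subspaces  carr V i  of an ambient vector space (type 'v);
  act is the g-action, dif i : V^i -> V^(i+1) the differential.\<close>
record ('k, 'g, 'v) dgmod =
  carr :: "int \<Rightarrow> 'v set"
  scl :: "'k \<Rightarrow> 'v \<Rightarrow> 'v"
  act :: "'g \<Rightarrow> 'v \<Rightarrow> 'v"
  dif :: "int \<Rightarrow> 'v \<Rightarrow> 'v"

definition is_dgmod :: "('k::field \<Rightarrow> 'g::ab_group_add \<Rightarrow> 'g) \<Rightarrow> ('g \<Rightarrow> 'g \<Rightarrow> 'g) \<Rightarrow>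
    ('k, 'g, 'v::ab_group_add) dgmod \<Rightarrow> bool" where
  "is_dgmod sG br V \<longleftrightarrow>
     (\<forall>i. gmod sG br (scl V) (act V) (carr V i)) \<and>
     (\<exists>N::int. \<forall>i. N < \<bar>i\<bar> \<longrightarrow> carr V i = {0}) \<and>
     (\<forall>i. \<forall>v\<in>carr V i. dif V i v \<in> carr V (i + 1)) \<and>
     (\<forall>i. \<forall>v\<in>carr V i. \<forall>w\<in>carr V i. dif V i (v + w) = dif V i v + dif V i w) \<and>
     (\<forall>i c. \<forall>v\<in>carr V i. dif V i (scl V c v) = scl V c (dif V i v)) \<and>
     (\<forall>i. \<forall>v\<in>carr V i. dif V (i + 1) (dif V i v) = 0) \<and>
     (\<forall>i x. \<forall>v\<in>carr V i. dif V i (act V x v) = act V x (dif V i v))"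

definition nonneg :: "('k, 'g, 'v::zero) dgmod \<Rightarrow> bool" where
  "nonneg V \<longleftrightarrow> (\<forall>i<0. carr V i = {0})"

text \<open>For a non-negative dg module, H^0(V) = ker d_0.\<close>
definition kerd0 :: "('k, 'g, 'v::zero) dgmod \<Rightarrow> 'v set" where
  "kerd0 V = {v \<in> carr V 0. dif V 0 v = 0}"

definition dg_lift :: "('k::field \<Rightarrow> 'g::ab_group_add \<Rightarrow> 'g) \<Rightarrow> ('g \<Rightarrow> 'g \<Rightarrow> 'g) \<Rightarrow>
    ('k, 'g, 'v::ab_group_add) dgmod \<Rightarrow> ('k \<Rightarrow> 'e::ab_group_add \<Rightarrow> 'e) \<Rightarrow> ('g \<Rightarrow> 'e \<Rightarrow> 'e) \<Rightarrow>
    ('e \<Rightarrow> 'v) \<Rightarrow> bool" where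
  "dg_lift sG br V sE rhoE iE \<longleftrightarrow> nonneg V \<and>
     gmod_hom sE rhoE (scl V) (act V) UNIV iE \<and> bij_betw iE UNIV (kerd0 V)"

definition resolution :: "('k, 'g, 'v::ab_group_add) dgmod \<Rightarrow> bool" where
  "resolution V \<longleftrightarrow> (\<forall>i\<ge>1. \<forall>v\<in>carr V i. dif V i v = 0 \<longrightarrow>
       (\<exists>u\<in>carr V (i - 1). dif V (i - 1) u = v))"

section \<open>Forms: \<wedge>^p g^\<or> \<otimes> M as alternating p-multilinear maps g^p -> M
  (g finite-dimensional); maps are normalized to 0 on argument lists of wrong length.\<close>

definition altform :: "('k::field \<Rightarrow> 'g::ab_group_add \<Rightarrow> 'g) \<Rightarrow> ('k \<Rightarrow> 'v::ab_group_add \<Rightarrow> 'v) \<Rightarrow>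
    nat \<Rightarrow> 'v set \<Rightarrow> ('g list \<Rightarrow> 'v) \<Rightarrow> bool" where
  "altform sG sV p M \<omega> \<longleftrightarrow>
     (\<forall>xs. length xs = p \<longrightarrow> \<omega> xs \<in> M) \<and>
     (\<forall>xs. length xs \<noteq> p \<longrightarrow> \<omega> xs = 0) \<and>
     (\<forall>as bs x y. length as + length bs + 1 = p \<longrightarrow>
        \<omega> (as @ (x + y) # bs) = \<omega> (as @ x # bs) + \<omega> (as @ y # bs)) \<and>
     (\<forall>as bs c x. length as + length bs + 1 = p \<longrightarrow>
        \<omega> (as @ sG c x # bs) = sV c (\<omega> (as @ x # bs))) \<and>
     (\<forall>as bs cs x. length as + length bs + length cs + 2 = p \<longrightarrow>
        \<omega> (as @ x # bs @ x # cs) = 0)"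

definition OmegaV :: "('k::field \<Rightarrow> 'g::ab_group_add \<Rightarrow> 'g) \<Rightarrow> ('k, 'g, 'v::ab_group_add) dgmod \<Rightarrow>
    int \<Rightarrow> (nat \<Rightarrow> 'g list \<Rightarrow> 'v) \<Rightarrow> bool" where
  "OmegaV sG V m \<xi> \<longleftrightarrow> (\<forall>p. altform sG (scl V) p (carr V (m - int p)) (\<xi> p))"

definition del :: "nat \<Rightarrow> 'a list \<Rightarrow> 'a list" where
  "del i xs = take i xs @ drop (Suc i) xs"

definition ce :: "('g \<Rightarrow> 'g \<Rightarrow> 'g) \<Rightarrow> ('k::field \<Rightarrow> 'v::ab_group_add \<Rightarrow> 'v) \<Rightarrow> ('g \<Rightarrow> 'v \<Rightarrow> 'v) \<Rightarrow>
    nat \<Rightarrow> ('g list \<Rightarrow> 'v) \<Rightarrow> 'g list \<Rightarrow> 'v" where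
  "ce br sV rho q \<omega> xs = (if length xs = Suc q then
      (\<Sum>i<Suc q. sV ((-1) ^ i) (rho (xs ! i) (\<omega> (del i xs)))) +
      (\<Sum>i<Suc q. \<Sum>j\<in>{i<..<Suc q}.
          sV ((-1) ^ (i + j)) (\<omega> (br (xs ! i) (xs ! j) # del i (del j xs))))
    else 0)"

definition dtot :: "('g \<Rightarrow> 'g \<Rightarrow> 'g) \<Rightarrow> ('k::field, 'g, 'v::ab_group_add) dgmod \<Rightarrow> int \<Rightarrow>
    (nat \<Rightarrow> 'g list \<Rightarrow> 'v) \<Rightarrow> (nat \<Rightarrow> 'g list \<Rightarrow> 'v)" where
  "dtot br V m \<xi> = (\<lambda>p xs.
     (if p = 0 then 0 else ce br (scl V) (act V) (p - 1) (\<xi> (p - 1)) xs) +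
     scl V ((-1) ^ p) (dif V (m - int p) (\<xi> p xs)))"

definition permlist :: "(nat \<Rightarrow> nat) \<Rightarrow> 'a list \<Rightarrow> 'a list" where
  "permlist \<sigma> xs = map (\<lambda>i. xs ! \<sigma> i) [0..<length xs]"

text \<open>Wedge product of a scalar a-form with a V-valued p-form (shuffle convention).\<close>
definition wedge :: "('k::field_char_0 \<Rightarrow> 'v::ab_group_add \<Rightarrow> 'v) \<Rightarrow> nat \<Rightarrow> nat \<Rightarrow>
    ('g list \<Rightarrow> 'k) \<Rightarrow> ('g list \<Rightarrow> 'v) \<Rightarrow> 'g list \<Rightarrow> 'v" where
  "wedge sV a p \<alpha> \<omega> xs = (if length xs = a + p then
      sV (inverse (fact a * fact p))
        (\<Sum>\<sigma>\<in>{\<sigma>. \<sigma> permutes {..<a + p}}.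
           sV (of_int (sign \<sigma>) * \<alpha> (take a (permlist \<sigma> xs))) (\<omega> (drop a (permlist \<sigma> xs))))
    else 0)"

definition wedgeO :: "('k::field_char_0 \<Rightarrow> 'v::ab_group_add \<Rightarrow> 'v) \<Rightarrow> nat \<Rightarrow>
    ('g list \<Rightarrow> 'k) \<Rightarrow> (nat \<Rightarrow> 'g list \<Rightarrow> 'v) \<Rightarrow> (nat \<Rightarrow> 'g list \<Rightarrow> 'v)" where
  "wedgeO sV a \<alpha> \<xi> = (\<lambda>p. if a \<le> p then wedge sV a (p - a) \<alpha> (\<xi> (p - a)) else (\<lambda>xs. 0))"

definition weak_morph :: "('k::field_char_0 \<Rightarrow> 'g::ab_group_add \<Rightarrow> 'g) \<Rightarrow> ('g \<Rightarrow> 'g \<Rightarrow> 'g) \<Rightarrow>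
    ('k, 'g, 'v::ab_group_add) dgmod \<Rightarrow> ('k, 'g, 'w::ab_group_add) dgmod \<Rightarrow>
    (int \<Rightarrow> (nat \<Rightarrow> 'g list \<Rightarrow> 'v) \<Rightarrow> (nat \<Rightarrow> 'g list \<Rightarrow> 'w)) \<Rightarrow> bool" where
  "weak_morph sG br V W f \<longleftrightarrow>
     (\<forall>m \<xi>. OmegaV sG V m \<xi> \<longrightarrow> OmegaV sG W m (f m \<xi>)) \<and>
     (\<forall>m \<xi> \<eta>. OmegaV sG V m \<xi> \<longrightarrow> OmegaV sG V m \<eta> \<longrightarrow>
        f m (\<lambda>p xs. \<xi> p xs + \<eta> p xs) = (\<lambda>p xs. f m \<xi> p xs + f m \<eta> p xs)) \<and>
     (\<forall>m a \<alpha> \<xi>. altform sG (*) a UNIV \<alpha> \<longrightarrow> OmegaV sG V m \<xi> \<longrightarrow>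
        f (m + int a) (wedgeO (scl V) a \<alpha> \<xi>) = wedgeO (scl W) a \<alpha> (f m \<xi>)) \<and>
     (\<forall>m \<xi>. OmegaV sG V m \<xi> \<longrightarrow> f (m + 1) (dtot br V m \<xi>) = dtot br W m (f m \<xi>))"

text \<open>Homotopy: a degree -1 Omega_g-linear map h (graded linear with the Koszul sign).\<close>
definition homotopic :: "('k::field_char_0 \<Rightarrow> 'g::ab_group_add \<Rightarrow> 'g) \<Rightarrow> ('g \<Rightarrow> 'g \<Rightarrow> 'g) \<Rightarrow>
    ('k, 'g, 'v::ab_group_add) dgmod \<Rightarrow> ('k, 'g, 'w::ab_group_add) dgmod \<Rightarrow>
    (int \<Rightarrow> (nat \<Rightarrow> 'g list \<Rightarrow> 'v) \<Rightarrow> (nat \<Rightarrow> 'g list \<Rightarrow> 'w)) \<Rightarrow>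
    (int \<Rightarrow> (nat \<Rightarrow> 'g list \<Rightarrow> 'v) \<Rightarrow> (nat \<Rightarrow> 'g list \<Rightarrow> 'w)) \<Rightarrow> bool" where
  "homotopic sG br V W f f' \<longleftrightarrow> (\<exists>h.
     (\<forall>m \<xi>. OmegaV sG V m \<xi> \<longrightarrow> OmegaV sG W (m - 1) (h m \<xi>)) \<and>
     (\<forall>m \<xi> \<eta>. OmegaV sG V m \<xi> \<longrightarrow> OmegaV sG V m \<eta> \<longrightarrow>
        h m (\<lambda>p xs. \<xi> p xs + \<eta> p xs) = (\<lambda>p xs. h m \<xi> p xs + h m \<eta> p xs)) \<and>
     (\<forall>m a \<alpha> \<xi>. altform sG (*) a UNIV \<alpha> \<longrightarrow> OmegaV sG V m \<xi> \<longrightarrow>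
        h (m + int a) (wedgeO (scl V) a \<alpha> \<xi>) =
        (\<lambda>p xs. scl W ((-1) ^ a) (wedgeO (scl W) a \<alpha> (h m \<xi>) p xs))) \<and>
     (\<forall>m \<xi>. OmegaV sG V m \<xi> \<longrightarrow>
        (\<lambda>p xs. f' m \<xi> p xs - f m \<xi> p xs) =
        (\<lambda>p xs. dtot br W (m - 1) (h m \<xi>) p xs + h (m + 1) (dtot br V m \<xi>) p xs)))"

text \<open>The element 1 \<otimes> v of Omega^0(V) for v in V^0, and the component f_0^0.\<close>
definition incl0 :: "'v::zero \<Rightarrow> nat \<Rightarrow> 'g list \<Rightarrow> 'v" where
  "incl0 v = (\<lambda>p xs. if p = 0 \<and> xs = [] then v else 0)"

definition f00 :: "(int \<Rightarrow> (nat \<Rightarrow> 'g list \<Rightarrow> 'v::zero) \<Rightarrow> (nat \<Rightarrow> 'g list \<Rightarrow> 'w)) \<Rightarrow> 'v \<Rightarrow> 'w" where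
  "f00 f v = f 0 (incl0 v) 0 []"

text \<open>f is a dg lift of phi : E -> F (V, W non-negative, so H^0 = ker d_0, identified with
  E, F via iE, iF).\<close>
definition is_dg_lift_of :: "(int \<Rightarrow> (nat \<Rightarrow> 'g list \<Rightarrow> 'v::zero) \<Rightarrow> (nat \<Rightarrow> 'g list \<Rightarrow> 'w)) \<Rightarrow>
    ('e \<Rightarrow> 'v) \<Rightarrow> ('f \<Rightarrow> 'w) \<Rightarrow> ('e \<Rightarrow> 'f) \<Rightarrow> bool" where
  "is_dg_lift_of f iE iF phi \<longleftrightarrow> (\<forall>e. f00 f (iE e) = iF (phi e))"

end

theory Submission
  imports Defs "Jordan_Normal_Form.Determinant"
begin

text \<open>A resolution \<open>V\<close> of \<open>E\<close> has a linear, in general not equivariant, contraction \<open>s\<close> onto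
  \<open>ker d\<^sub>0\<close>. Let \<open>S\<close> be its \<open>\<Omega>\<close>-linear extension, of degree \<open>-1\<close>. Then
  \<open>P = id - (d\<^sub>t\<^sub>o\<^sub>t S + S d\<^sub>t\<^sub>o\<^sub>t)\<close> is a chain map homotopic to the identity. The \<open>d s + s d\<close> part cancels
  \<open>id\<close> except for a projection in degree \<open>0\<close>, and the remaining part \<open>ce S + S ce\<close> is
  \<open>\<Omega>\<close>-linear, because the bracket terms cancel, and moves \<open>\<wedge>\<^sup>p \<otimes> V\<^sup>q\<close> to \<open>\<wedge>\<^sup>p\<^sup>+\<^sup>1 \<otimes> V\<^sup>q\<^sup>-\<^sup>1\<close>. As \<open>V\<close> is bounded, a
  power \<open>Q\<close> of \<open>P\<close> takes values in \<open>\<Omega>(ker d\<^sub>0)\<close>. Composing \<open>Q\<close> with \<open>\<phi>\<close> gives a lift. If \<open>f\<close> and \<open>f'\<close> are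
  lifts, then \<open>f' - f\<close> vanishes on \<open>\<Omega>(ker d\<^sub>0)\<close>, which is generated by \<open>ker d\<^sub>0\<close> since \<open>\<gg>\<close> is
  finite-dimensional, so \<open>f' - f\<close> equals \<open>(f' - f) (id - Q)\<close> and is null-homotopic.\<close>

section \<open>Contraction of a wedge product with a vector\<close>

definition insert_at :: "nat \<Rightarrow> 'a \<Rightarrow> 'a list \<Rightarrow> 'a list" where
  "insert_at k x ys = take k ys @ x # drop k ys"

text \<open>The inserted permutation sends position \<open>k\<close> to index 0, where
  \<open>x\<close> sits, and acts as \<open>q\<close> on the other positions. So permuting
  \<open>x # xs\<close> amounts to permuting \<open>xs\<close> and putting \<open>x\<close> back at
  position \<open>k\<close>.\<close>

lemma permlist_permutation_insert:
  assumes q: "q permutes {0..<length xs}" and k: "k \<le> length xs"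
  shows "permlist (permutation_insert k 0 q) (x # xs) = insert_at k x (permlist q xs)"
proof (rule nth_equalityI)
  show "length (permlist (permutation_insert k 0 q) (x # xs)) = length (insert_at k x (permlist q xs))"
    using k by (simp add: permlist_def insert_at_def)
  fix i assume "i < length (permlist (permutation_insert k 0 q) (x # xs))"
  then have i: "i < Suc (length xs)" by (simp add: permlist_def)
  then show "permlist (permutation_insert k 0 q) (x # xs) ! i = insert_at k x (permlist q xs) ! i"
    using k by (auto simp: permlist_def insert_at_def permutation_insert_expand nth_append
        min_def nth_Cons' simp del: upt_Suc)
qed

text \<open>Permutations are sorted by the position \<open>k\<close> that is sent to 0, as in the
  Laplace expansion of a determinant; removing that position leaves a permutation of
  \<open>n\<close> points.\<close>

lemma sum_permutes_Suc:
  fixes F :: "(nat \<Rightarrow> nat) \<Rightarrow> 'b::comm_monoid_add"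
  shows "(\<Sum>\<sigma> | \<sigma> permutes {..<Suc n}. F \<sigma>) =
    (\<Sum>k<Suc n. \<Sum>q | q permutes {..<n}. F (permutation_insert k 0 q))"
proof -
  have "(\<Sum>\<sigma> | \<sigma> permutes {0..<Suc n}. F \<sigma>) =
      (\<Sum>k\<in>{0..<Suc n}. \<Sum>\<sigma> | \<sigma> permutes {0..<Suc n} \<and> \<sigma> k = 0. F \<sigma>)"
  proof (subst permutation_split_ran[of 0], simp, rule sum.UNION_disjoint)
    show "\<forall>k\<in>{0..<Suc n}. finite {\<sigma>. \<sigma> permutes {0..<Suc n} \<and> \<sigma> k = 0}"
      by (auto intro: finite_subset[OF _ finite_permutations[of "{0..<Suc n}"]])
    show "\<forall>k\<in>{0..<Suc n}. \<forall>l\<in>{0..<Suc n}. k \<noteq> l \<longrightarrow>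
        {\<sigma>. \<sigma> permutes {0..<Suc n} \<and> \<sigma> k = 0} \<inter> {\<sigma>. \<sigma> permutes {0..<Suc n} \<and> \<sigma> l = 0} = {}"
      by (intro ballI impI permutation_disjoint_dom) auto
  qed simp
  also have "\<dots> = (\<Sum>k\<in>{0..<Suc n}. \<Sum>q | q permutes {0..<n}. F (permutation_insert k 0 q))"
    by (rule sum.cong[OF refl], subst permutation_fix)
      (auto simp: sum.reindex[OF permutation_insert_inj_on])
  finally show ?thesis by (simp add: atLeast0LessThan)
qed

lemma altformD:
  assumes "altform sG sV p M \<omega>"
  shows "length xs = p \<Longrightarrow> \<omega> xs \<in> M" "length xs \<noteq> p \<Longrightarrow> \<omega> xs = 0"
    "length as + length bs + 1 = p \<Longrightarrow> \<omega> (as @ (x + y) # bs) = \<omega> (as @ x # bs) + \<omega> (as @ y # bs)"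
    "length as + length bs + 1 = p \<Longrightarrow> \<omega> (as @ sG c x # bs) = sV c (\<omega> (as @ x # bs))"
    "length as + length bs + length cs + 2 = p \<Longrightarrow> \<omega> (as @ x # bs @ x # cs) = 0"
  using assms unfolding altform_def by blast+

lemma altform_Cons_add:
  assumes "altform sG sV p M \<omega>"
  shows "\<omega> ((x + y) # bs) = \<omega> (x # bs) + \<omega> (y # bs)"
  using altformD(2)[OF assms] altformD(3)[OF assms, of "[]"] by (cases "length bs + 1 = p") auto

lemma altform_Cons_zero:
  assumes "altform sG sV p M \<omega>"
  shows "\<omega> (0 # bs) = 0"
  using altform_Cons_add[OF assms, of 0 0 bs] by simp

text \<open>Polarization: the value with \<open>x + y\<close> in both adjacent slots is zero, and
  expanding it leaves only the two mixed terms.\<close>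

lemma altform_swap:
  assumes A: "altform sG sV p M \<omega>"
  shows "\<omega> (as @ x # y # bs) = - \<omega> (as @ y # x # bs)"
proof (cases "length as + length bs + 2 = p")
  case True
  have z: "\<omega> (as @ u # u # bs) = 0" for u
    using altformD(5)[OF A, of as "[]" bs u] True by simp
  have a1: "\<omega> (as @ (x + y) # (x + y) # bs) = \<omega> (as @ x # (x + y) # bs) + \<omega> (as @ y # (x + y) # bs)"
    by (rule altformD(3)[OF A]) (use True in auto)
  have a2: "\<omega> (as @ u # (x + y) # bs) = \<omega> (as @ u # x # bs) + \<omega> (as @ u # y # bs)" for u
    using altformD(3)[OF A, of "as @ [u]" bs x y] True by simp
  show ?thesis using a1 by (simp add: z a2 eq_neg_iff_add_eq_0)
qed (use altformD(2)[OF A] in auto)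

lemma altform_move:
  assumes "vector_space sV" and A: "altform sG sV p M \<omega>"
  shows "\<omega> (as @ x # bs) = sV ((- 1) ^ length as) (\<omega> (x # as @ bs))"
proof (induction as arbitrary: bs rule: rev_induct)
  case Nil
  interpret vector_space sV by fact
  show ?case by simp
next
  case (snoc a as)
  interpret vector_space sV by fact
  have "\<omega> ((as @ [a]) @ x # bs) = - \<omega> (as @ x # a # bs)"
    using altform_swap[OF A, of as a x bs] by simp
  also have "\<dots> = - sV ((- 1) ^ length as) (\<omega> (x # as @ a # bs))"
    by (simp add: snoc.IH)
  finally show ?case by simp
qed

lemma altform_insert_at:
  assumes "vector_space sV" "altform sG sV p M \<omega>" "k \<le> length ys"
  shows "\<omega> (insert_at k x ys) = sV ((- 1) ^ k) (\<omega> (x # ys))"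
  using altform_move[OF assms(1,2), of "take k ys" x "drop k ys"] assms(3)
  by (simp add: insert_at_def min_def)

lemma take_insert_at:
  "k < a \<Longrightarrow> k \<le> length ys \<Longrightarrow> take a (insert_at k x ys) = insert_at k x (take (a - 1) ys)"
  "a \<le> k \<Longrightarrow> k \<le> length ys \<Longrightarrow> take a (insert_at k x ys) = take a ys"
  by (auto simp: insert_at_def take_Cons' min_def drop_take)

lemma drop_insert_at:
  "k < a \<Longrightarrow> k \<le> length ys \<Longrightarrow> drop a (insert_at k x ys) = drop (a - 1) ys"
  "a \<le> k \<Longrightarrow> k \<le> length ys \<Longrightarrow> drop a (insert_at k x ys) = insert_at (k - a) x (drop a ys)"
  by (auto simp: insert_at_def drop_Cons' min_def drop_take)

lemma length_permlist [simp]: "length (permlist \<sigma> xs) = length xs"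
  by (simp add: permlist_def)

lemma vector_space_mult: "vector_space ((*) :: 'k::field \<Rightarrow> 'k \<Rightarrow> 'k)"
  by unfold_locales (auto simp: algebra_simps)

text \<open>If \<open>k < a\<close>, then \<open>x\<close> falls among the arguments of
  \<open>\<alpha>\<close>, and the sign of the permutation cancels the sign of moving
  \<open>x\<close> to the front. Otherwise \<open>x\<close> is at place \<open>k - a\<close> of
  \<open>\<omega>\<close> and a sign \<open>(- 1) ^ a\<close> survives. The result depends on
  \<open>k\<close> only through the test \<open>k < a\<close>.\<close>

lemma wedge_term_insert:
  fixes sV :: "'k::field_char_0 \<Rightarrow> 'v::ab_group_add \<Rightarrow> 'v"
  assumes vs: "vector_space sV"
    and A: "altform sG (*) a UNIV \<alpha>" and W: "altform sG sV p M \<omega>"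
    and len: "length xs + 1 = a + p" and q: "q permutes {..<length xs}" and k: "k \<le> length xs"
  defines "t \<equiv> \<lambda>\<sigma> zs. sV (of_int (sign \<sigma>) * \<alpha> (take a (permlist \<sigma> zs))) (\<omega> (drop a (permlist \<sigma> zs)))"
    and "ys \<equiv> permlist q xs"
  shows "t (permutation_insert k 0 q) (x # xs) =
    (if k < a then sV (of_int (sign q) * \<alpha> (x # take (a - 1) ys)) (\<omega> (drop (a - 1) ys))
     else sV ((- 1) ^ a) (sV (of_int (sign q) * \<alpha> (take a ys)) (\<omega> (x # drop a ys))))"
proof -
  interpret vector_space sV by fact
  have q': "q permutes {0..<length xs}" using q by (simp add: atLeast0LessThan)
  have sg: "(of_int (sign (permutation_insert k 0 q)) :: 'k) = (- 1) ^ k * of_int (sign q)"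
    using signof_permutation_insert[OF q', of k 0, where 'a = 'k] k by simp
  have pl: "permlist (permutation_insert k 0 q) (x # xs) = insert_at k x ys"
    using permlist_permutation_insert[OF q' k] by (simp add: ys_def)
  have [simp]: "length ys = length xs" by (simp add: ys_def)
  have e: "(- 1 :: 'k) ^ n * ((- 1) ^ n * c) = c" for n c
    by (simp flip: mult.assoc power_add mult_2)
  show ?thesis
  proof (cases "k < a")
    case True
    have "\<alpha> (insert_at k x (take (a - 1) ys)) = (- 1) ^ k * \<alpha> (x # take (a - 1) ys)"
      by (rule altform_insert_at[OF vector_space_mult A]) (use True k in auto)
    with True show ?thesis
      using k by (simp add: t_def pl sg take_insert_at drop_insert_at e ac_simps)
  next
    case False
    have "\<omega> (insert_at (k - a) x (drop a ys)) = sV ((- 1) ^ (k - a)) (\<omega> (x # drop a ys))"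
      by (rule altform_insert_at[OF vs W]) (use False k in auto)
    moreover have "(- 1 :: 'k) ^ k = (- 1) ^ (k - a) * (- 1) ^ a"
      using False by (simp flip: power_add)
    ultimately show ?thesis using False
      using k by (simp add: t_def pl sg take_insert_at drop_insert_at e ac_simps)
  qed
qed

text \<open>Contraction is an antiderivation. In the sum over permutations the position of
  \<open>x\<close> takes \<open>a\<close> values inside \<open>\<alpha>\<close> and \<open>p\<close>
  values inside \<open>\<omega>\<close>, all with equal contributions. These factors lower the
  factorials in the normalization of \<open>wedge\<close>.\<close>

lemma wedge_Cons:
  fixes sV :: "'k::field_char_0 \<Rightarrow> 'v::ab_group_add \<Rightarrow> 'v"
  assumes vs: "vector_space sV"
    and A: "altform sG (*) a UNIV \<alpha>" and W: "altform sG sV p M \<omega>"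
    and len: "length xs + 1 = a + p"
  shows "wedge sV a p \<alpha> \<omega> (x # xs) =
    (if a = 0 then 0 else wedge sV (a - 1) p (\<lambda>ys. \<alpha> (x # ys)) \<omega> xs) +
    (if p = 0 then 0 else sV ((- 1) ^ a) (wedge sV a (p - 1) \<alpha> (\<lambda>ys. \<omega> (x # ys)) xs))"
proof -
  interpret vector_space sV by fact
  define n where "n = length xs"
  let ?S = "{q. q permutes {..<n}}"
  let ?A = "\<Sum>q\<in>?S. sV (of_int (sign q) * \<alpha> (x # take (a - 1) (permlist q xs))) (\<omega> (drop (a - 1) (permlist q xs)))"
  let ?B = "\<Sum>q\<in>?S. sV (of_int (sign q) * \<alpha> (take a (permlist q xs))) (\<omega> (x # drop a (permlist q xs)))"
  have ap: "a + p = Suc n" using len by (simp add: n_def)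
  have "(\<Sum>\<sigma> | \<sigma> permutes {..<a + p}. sV (of_int (sign \<sigma>) * \<alpha> (take a (permlist \<sigma> (x # xs)))) (\<omega> (drop a (permlist \<sigma> (x # xs)))))
     = (\<Sum>k<Suc n. if k < a then ?A else sV ((- 1) ^ a) ?B)"
    unfolding ap sum_permutes_Suc scale_sum_right
    by (intro sum.cong refl) (auto intro!: sum.cong simp: n_def wedge_term_insert[OF vs A W len])
  also have "\<dots> = (\<Sum>k<a. ?A) + (\<Sum>k=a..<a + p. sV ((- 1) ^ a) ?B)"
    unfolding ap[symmetric] by (subst lessThan_atLeast0, subst sum.atLeastLessThan_concat[of 0 a "a + p", symmetric])
      (auto simp: lessThan_atLeast0)
  also have "\<dots> = sV (of_nat a) ?A + sV (of_nat p) (sV ((- 1) ^ a) ?B)"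
    by (simp add: sum_constant_scale)
  finally have E: "wedge sV a p \<alpha> \<omega> (x # xs) =
      sV (inverse (fact a * fact p) * of_nat a) ?A + sV (inverse (fact a * fact p) * of_nat p * (- 1) ^ a) ?B"
    using len by (simp add: wedge_def scale_right_distrib mult.assoc)
  have 1: "sV (inverse (fact a * fact p) * of_nat a) ?A =
     (if a = 0 then 0 else wedge sV (a - 1) p (\<lambda>ys. \<alpha> (x # ys)) \<omega> xs)"
  proof (cases a)
    case (Suc b)
    then have "inverse (fact a * fact p) * of_nat a = (inverse (fact b * fact p) :: 'k)"
      by (simp add: field_simps del: of_nat_Suc)
    then show ?thesis using Suc ap by (simp add: wedge_def n_def)
  qed simp
  have 2: "sV (inverse (fact a * fact p) * of_nat p * (- 1) ^ a) ?B =
     (if p = 0 then 0 else sV ((- 1) ^ a) (wedge sV a (p - 1) \<alpha> (\<lambda>ys. \<omega> (x # ys)) xs))"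
  proof (cases p)
    case (Suc b)
    then have "inverse (fact a * fact p) * of_nat p = (inverse (fact a * fact b) :: 'k)"
      by (simp add: field_simps del: of_nat_Suc)
    then show ?thesis using Suc ap by (simp add: wedge_def n_def mult.commute)
  qed simp
  show ?thesis unfolding E 1 2 ..
qed

section \<open>Cartan calculus for the Chevalley-Eilenberg differential\<close>

text \<open>Recursion along Cartan's formulas \<open>\<iota>\<^sub>y L\<^sub>x = L\<^sub>x \<iota>\<^sub>y - \<iota>\<^bsub>[x,y]\<^esub>\<close> and \<open>\<iota>\<^sub>x d = L\<^sub>x - d \<iota>\<^sub>x\<close>, where
  \<open>\<iota>\<^sub>x \<omega> = (\<lambda>ys. \<omega> (x # ys))\<close>; likewise \<open>insD \<psi>\<close> is left multiplication by the 1-form \<open>\<psi>\<close>.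
  No form degree is needed, and identities are proved by induction on the argument list.\<close>

fun lieD :: "('g \<Rightarrow> 'g \<Rightarrow> 'g) \<Rightarrow> ('g \<Rightarrow> 'v \<Rightarrow> 'v) \<Rightarrow> 'g \<Rightarrow> ('g list \<Rightarrow> 'v) \<Rightarrow> 'g list \<Rightarrow> 'v::ab_group_add" where
  "lieD br rho x \<omega> [] = rho x (\<omega> [])"
| "lieD br rho x \<omega> (y # ys) = lieD br rho x (\<lambda>zs. \<omega> (y # zs)) ys - \<omega> (br x y # ys)"

fun ceD :: "('g \<Rightarrow> 'g \<Rightarrow> 'g) \<Rightarrow> ('g \<Rightarrow> 'v \<Rightarrow> 'v) \<Rightarrow> ('g list \<Rightarrow> 'v) \<Rightarrow> 'g list \<Rightarrow> 'v::ab_group_add" where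
  "ceD br rho \<omega> [] = 0"
| "ceD br rho \<omega> (x # xs) = lieD br rho x \<omega> xs - ceD br rho (\<lambda>zs. \<omega> (x # zs)) xs"

fun insD :: "('g \<Rightarrow> 'v \<Rightarrow> 'w) \<Rightarrow> ('g list \<Rightarrow> 'v) \<Rightarrow> 'g list \<Rightarrow> 'w::ab_group_add" where
  "insD \<psi> \<omega> [] = 0"
| "insD \<psi> \<omega> (x # xs) = \<psi> x (\<omega> xs) - insD \<psi> (\<lambda>zs. \<omega> (x # zs)) xs"

section \<open>Alternating forms recognized through their contractions\<close>

lemma altform_0_iff: "altform sG sV 0 M \<omega> \<longleftrightarrow> \<omega> [] \<in> M \<and> (\<forall>xs. xs \<noteq> [] \<longrightarrow> \<omega> xs = 0)"
  by (auto simp: altform_def)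

lemma altform_0_Cons: "altform sG sV 0 M \<omega> \<Longrightarrow> \<omega> (x # xs) = 0"
  by (simp add: altform_0_iff)

lemma altform_Cons:
  assumes A: "altform sG sV (Suc p) M \<omega>"
  shows "altform sG sV p M (\<lambda>ys. \<omega> (x # ys))"
  unfolding altform_def
  using altformD[OF A] by (auto simp flip: append_Cons)

text \<open>If all contractions are alternating, only the first slot remains to be checked. A
  repetition of the first argument further along the list moves into a contraction after a swap of
  the first two arguments, and the swap rule comes from polarization.\<close>

lemma altform_SucI:
  assumes nil: "\<omega> [] = 0"
    and iota: "\<And>x. altform sG sV p M (\<lambda>ys. \<omega> (x # ys))"
    and add: "\<And>x y bs. length bs = p \<Longrightarrow> \<omega> ((x + y) # bs) = \<omega> (x # bs) + \<omega> (y # bs)"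
    and scl: "\<And>c x bs. length bs = p \<Longrightarrow> \<omega> (sG c x # bs) = sV c (\<omega> (x # bs))"
    and alt: "\<And>x cs. Suc (length cs) = p \<Longrightarrow> \<omega> (x # x # cs) = 0"
  shows "altform sG sV (Suc p) M \<omega>"
proof -
  have sw: "\<omega> (x # y # cs) = - \<omega> (y # x # cs)" if l: "Suc (length cs) = p" for x y cs
  proof -
    have a: "\<omega> (z # (x + y) # cs) = \<omega> (z # x # cs) + \<omega> (z # y # cs)" for z
      using altformD(3)[OF iota[of z], of "[]" cs x y] l by simp
    have "0 = \<omega> ((x + y) # (x + y) # cs)" by (simp add: alt l)
    also have "\<dots> = \<omega> (x # y # cs) + \<omega> (y # x # cs)"
      by (subst add) (simp_all add: l a alt)
    finally show ?thesis by (simp add: eq_neg_iff_add_eq_0)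
  qed
  have alt': "\<omega> (as @ x # bs @ x # cs) = 0" if l: "length as + length bs + length cs + 2 = Suc p" for as bs cs x
  proof (cases as)
    case Nil
    show ?thesis
    proof (cases bs)
      case Nil
      then show ?thesis using \<open>as = []\<close> alt l by simp
    next
      case (Cons b bs')
      have "\<omega> (x # b # bs' @ x # cs) = - \<omega> (b # x # bs' @ x # cs)"
        by (rule sw) (use l Cons \<open>as = []\<close> in auto)
      also have "\<omega> (b # x # bs' @ x # cs) = 0"
        using altformD(5)[OF iota[of b], of "[]" bs' cs x] l Cons \<open>as = []\<close> by simp
      finally show ?thesis using Cons \<open>as = []\<close> by simp
    qed
  next
    case (Cons a as')
    then show ?thesis using altformD(5)[OF iota[of a], of as' bs cs x] l by simp
  qed
  have add': "\<omega> (as @ (x + y) # bs) = \<omega> (as @ x # bs) + \<omega> (as @ y # bs)"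
    if "length as + length bs + 1 = Suc p" for as bs x y
    using that altformD(3)[OF iota, of "tl as" bs "hd as" x y] add by (cases as) auto
  have scl': "\<omega> (as @ sG c x # bs) = sV c (\<omega> (as @ x # bs))"
    if "length as + length bs + 1 = Suc p" for as bs c x
    using that altformD(4)[OF iota, of "tl as" bs "hd as" c x] scl by (cases as) auto
  have v: "\<omega> xs \<in> M" if "length xs = Suc p" for xs
    using that altformD(1)[OF iota, of "tl xs" "hd xs"] by (cases xs) auto
  have z: "\<omega> xs = 0" if "length xs \<noteq> Suc p" for xs
    using that altformD(2)[OF iota, of "tl xs" "hd xs"] nil by (cases xs) auto
  show ?thesis unfolding altform_def using v z add' scl' alt' by blast
qed

text \<open>Additivity without reference to a form degree. It passes to contractions as it stands,
  which suits inductions on the argument list, and together with membership in \<open>M\<close> it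
  is all that the Cartan identities ask of a form.\<close>

definition slot_additive :: "('g::plus list \<Rightarrow> 'v::plus) \<Rightarrow> bool" where
  "slot_additive \<omega> \<longleftrightarrow> (\<forall>as bs x y. \<omega> (as @ (x + y) # bs) = \<omega> (as @ x # bs) + \<omega> (as @ y # bs))"

lemma slot_additive_Cons: "slot_additive \<omega> \<Longrightarrow> slot_additive (\<lambda>ys. \<omega> (x # ys))"
  unfolding slot_additive_def by (auto simp flip: append_Cons)

lemma slot_additive_hd: "slot_additive \<omega> \<Longrightarrow> \<omega> ((x + y) # bs) = \<omega> (x # bs) + \<omega> (y # bs)"
  unfolding slot_additive_def by (metis append_Nil)

lemma altform_slot_additive: "altform sG sV p M \<omega> \<Longrightarrow> slot_additive \<omega>"
  unfolding slot_additive_def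
proof (intro allI)
  fix as bs x y assume A: "altform sG sV p M \<omega>"
  show "\<omega> (as @ (x + y) # bs) = \<omega> (as @ x # bs) + \<omega> (as @ y # bs)"
    using altformD(2)[OF A] altformD(3)[OF A, of as bs x y] by (cases "length as + length bs + 1 = p") auto
qed

lemma del_0_Cons [simp]: "del 0 (x # xs) = xs"
  and del_Suc_Cons [simp]: "del (Suc i) (x # xs) = x # del i xs"
  by (simp_all add: del_def)

section \<open>Cartan identities for a representation on a subspace\<close>

locale lie_rep =
  fixes sG :: "'k::field \<Rightarrow> 'g::ab_group_add \<Rightarrow> 'g" and br :: "'g \<Rightarrow> 'g \<Rightarrow> 'g"
    and sV :: "'k \<Rightarrow> 'v::ab_group_add \<Rightarrow> 'v" and rho :: "'g \<Rightarrow> 'v \<Rightarrow> 'v" and M :: "'v set"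
  assumes lie: "lie_algebra sG br" and rep: "gmod sG br sV rho M"
begin

sublocale vector_space sV
  using rep by (simp add: gmod_def)

abbreviation "Lie \<equiv> lieD br rho"
abbreviation "CE \<equiv> ceD br rho"

lemma subspace_M: "subspace M"
  using rep by (simp add: gmod_def)

lemmas M_closed [simp] = subspace_0[OF subspace_M] subspace_add[OF subspace_M]
  subspace_diff[OF subspace_M] subspace_neg[OF subspace_M] subspace_scale[OF subspace_M]

lemma rho_M [simp]: "v \<in> M \<Longrightarrow> rho x v \<in> M"
  and rho_add_left: "v \<in> M \<Longrightarrow> rho (x + y) v = rho x v + rho y v"
  and rho_scale_left: "v \<in> M \<Longrightarrow> rho (sG c x) v = sV c (rho x v)"
  and rho_add: "v \<in> M \<Longrightarrow> w \<in> M \<Longrightarrow> rho x (v + w) = rho x v + rho x w"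
  and rho_scale: "v \<in> M \<Longrightarrow> rho x (sV c v) = sV c (rho x v)"
  and rho_br: "v \<in> M \<Longrightarrow> rho (br x y) v = rho x (rho y v) - rho y (rho x v)"
  using rep by (simp_all add: gmod_def)

lemma rho_0 [simp]: "rho x 0 = 0"
  using rho_add[of 0 0 x] by simp

lemma rho_diff: "v \<in> M \<Longrightarrow> w \<in> M \<Longrightarrow> rho x (v - w) = rho x v - rho x w"
  using rho_add[of "v - w" w x] by simp

lemma br_add_left: "br (x + y) z = br x z + br y z"
  and br_add_right: "br x (y + z) = br x y + br x z"
  and br_scale_left: "br (sG c x) y = sG c (br x y)"
  and br_scale_right: "br x (sG c y) = sG c (br x y)"
  and br_self [simp]: "br x x = 0"
  and jacobi: "br x (br y z) + br y (br z x) + br z (br x y) = 0"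
  using lie by (simp_all add: lie_algebra_def bilinear_br_def)

lemma br_anti: "br x y = - br y x"
proof -
  have "0 = br (x + y) (x + y)" by simp
  also have "\<dots> = br x y + br y x" by (simp only: br_add_left br_add_right) simp
  finally show ?thesis by (simp add: eq_neg_iff_add_eq_0)
qed

lemma br_uminus_right: "br x (- y) = - br x y"
  by (metis add.right_inverse add_eq_0_iff br_add_right add_cancel_right_right)

text \<open>This is the Jacobi identity after two uses of antisymmetry: \<open>br x\<close> is a
  derivation of the bracket, the form in which it enters \<open>Lie_br\<close>.\<close>

lemma jacobi': "br x (br y z) = br (br x y) z + br y (br x z)"
proof -
  have "br y (br z x) = - br y (br x z)" "br z (br x y) = - br (br x y) z"
    by (subst br_anti[of z x], rule br_uminus_right) (rule br_anti)
  with jacobi[of x y z] show ?thesis by (simp add: algebra_simps)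
qed

lemma altform_mem: "altform sG sV p M \<omega> \<Longrightarrow> \<omega> xs \<in> M"
  using altformD(1,2)[of sG sV p M \<omega> xs] by (cases "length xs = p") auto

lemma altform_zero: "altform sG sV p M (\<lambda>xs. 0)"
  by (simp add: altform_def)

lemma altform_add:
  "altform sG sV p M \<omega> \<Longrightarrow> altform sG sV p M \<eta> \<Longrightarrow> altform sG sV p M (\<lambda>xs. \<omega> xs + \<eta> xs)"
  by (simp add: altform_def scale_right_distrib)

lemma altform_diff:
  "altform sG sV p M \<omega> \<Longrightarrow> altform sG sV p M \<eta> \<Longrightarrow> altform sG sV p M (\<lambda>xs. \<omega> xs - \<eta> xs)"
  by (simp add: altform_def scale_right_diff_distrib)

lemma altform_scale:
  "altform sG sV p M \<omega> \<Longrightarrow> altform sG sV p M (\<lambda>xs. sV c (\<omega> xs))"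
  by (simp add: altform_def scale_right_distrib mult.commute)

lemma Lie_mem: "(\<And>xs. \<omega> xs \<in> M) \<Longrightarrow> Lie x \<omega> xs \<in> M"
  by (induction xs arbitrary: \<omega>) auto

lemma Lie_zero [simp]: "Lie x (\<lambda>xs. 0) xs = 0"
  by (induction xs) auto

lemma Lie_add: "(\<And>xs. \<omega> xs \<in> M) \<Longrightarrow> (\<And>xs. \<eta> xs \<in> M) \<Longrightarrow>
    Lie x (\<lambda>xs. \<omega> xs + \<eta> xs) xs = Lie x \<omega> xs + Lie x \<eta> xs"
  by (induction xs arbitrary: \<omega> \<eta>) (auto simp: rho_add)

lemma Lie_diff: "(\<And>xs. \<omega> xs \<in> M) \<Longrightarrow> (\<And>xs. \<eta> xs \<in> M) \<Longrightarrow>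
    Lie x (\<lambda>xs. \<omega> xs - \<eta> xs) xs = Lie x \<omega> xs - Lie x \<eta> xs"
  by (induction xs arbitrary: \<omega> \<eta>) (auto simp: rho_diff)

lemma Lie_scale: "(\<And>xs. \<omega> xs \<in> M) \<Longrightarrow> Lie x (\<lambda>xs. sV c (\<omega> xs)) xs = sV c (Lie x \<omega> xs)"
  by (induction xs arbitrary: \<omega>) (auto simp: rho_scale scale_right_diff_distrib)

lemma CE_mem: "(\<And>xs. \<omega> xs \<in> M) \<Longrightarrow> CE \<omega> xs \<in> M"
  by (induction xs arbitrary: \<omega>) (auto simp: Lie_mem)

lemma CE_zero [simp]: "CE (\<lambda>xs. 0) xs = 0"
  by (induction xs) auto

lemma CE_add: "(\<And>xs. \<omega> xs \<in> M) \<Longrightarrow> (\<And>xs. \<eta> xs \<in> M) \<Longrightarrow>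
    CE (\<lambda>xs. \<omega> xs + \<eta> xs) xs = CE \<omega> xs + CE \<eta> xs"
  by (induction xs arbitrary: \<omega> \<eta>) (auto simp: Lie_add)

lemma CE_diff: "(\<And>xs. \<omega> xs \<in> M) \<Longrightarrow> (\<And>xs. \<eta> xs \<in> M) \<Longrightarrow>
    CE (\<lambda>xs. \<omega> xs - \<eta> xs) xs = CE \<omega> xs - CE \<eta> xs"
  by (induction xs arbitrary: \<omega> \<eta>) (auto simp: Lie_diff)

lemma CE_scale: "(\<And>xs. \<omega> xs \<in> M) \<Longrightarrow> CE (\<lambda>xs. sV c (\<omega> xs)) xs = sV c (CE \<omega> xs)"
  by (induction xs arbitrary: \<omega>) (auto simp: Lie_scale scale_right_diff_distrib)

text \<open>After contraction with \<open>z\<close> the cross terms of the two double Lie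
  derivatives are symmetric in \<open>x\<close> and \<open>y\<close> and cancel. The terms with a
  double bracket combine by the Jacobi identity, and the rest is the induction hypothesis.\<close>

lemma Lie_br:
  assumes "\<And>xs. \<omega> xs \<in> M" "slot_additive \<omega>"
  shows "Lie (br x y) \<omega> xs = Lie x (Lie y \<omega>) xs - Lie y (Lie x \<omega>) xs"
  using assms
proof (induction xs arbitrary: \<omega>)
  case Nil
  then show ?case by (simp add: rho_br)
next
  case (Cons z zs)
  let ?i = "\<lambda>u ys. \<omega> (u # ys)"
  have e: "Lie u (Lie v \<omega>) (z # zs) =
      Lie u (Lie v (?i z)) zs - Lie u (?i (br v z)) zs - Lie v (?i (br u z)) zs + \<omega> (br v (br u z) # zs)" for u v
    using Cons.prems(1) by (simp add: Lie_diff Lie_mem)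
  have j: "\<omega> (br x (br y z) # zs) = \<omega> (br (br x y) z # zs) + \<omega> (br y (br x z) # zs)"
    using slot_additive_hd[OF Cons.prems(2)] jacobi'[of x y z] by simp
  have "Lie (br x y) (?i z) zs = Lie x (Lie y (?i z)) zs - Lie y (Lie x (?i z)) zs"
    by (rule Cons.IH) (use Cons.prems slot_additive_Cons in auto)
  then show ?case unfolding e using j by simp
qed

text \<open>Contracting both sides with \<open>y\<close> and using the recursions, the difference is
  exactly the defect of \<open>Lie_br\<close>, up to the induction hypothesis for the contracted
  form.\<close>

lemma Lie_CE:
  assumes "\<And>xs. \<omega> xs \<in> M" "slot_additive \<omega>"
  shows "Lie x (CE \<omega>) xs = CE (Lie x \<omega>) xs"
  using assms
proof (induction xs arbitrary: \<omega>)
  case Nil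
  then show ?case by simp
next
  case (Cons y ys)
  let ?i = "\<lambda>u ys. \<omega> (u # ys)"
  have IH: "Lie x (CE (?i y)) ys = CE (Lie x (?i y)) ys"
    by (rule Cons.IH) (use Cons.prems slot_additive_Cons in auto)
  have "Lie x (CE \<omega>) (y # ys) = Lie x (Lie y \<omega>) ys - Lie x (CE (?i y)) ys
      - (Lie (br x y) \<omega> ys - CE (?i (br x y)) ys)"
    using Cons.prems(1) by (simp add: Lie_diff Lie_mem CE_mem)
  moreover have "CE (Lie x \<omega>) (y # ys) = Lie y (Lie x \<omega>) ys - (CE (Lie x (?i y)) ys - CE (?i (br x y)) ys)"
    using Cons.prems(1) by (simp add: CE_diff Lie_mem CE_mem)
  ultimately show ?case using Lie_br[OF Cons.prems, of x y ys] IH by simp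
qed

text \<open>By two uses of Cartan's formula, the contraction of \<open>CE (CE \<omega>)\<close> with
  \<open>x\<close> is the commutator of \<open>Lie x\<close> and \<open>CE\<close> plus the double
  differential of a contraction. The first is zero by \<open>Lie_CE\<close>, the second by
  induction.\<close>

lemma CE_CE:
  assumes "\<And>xs. \<omega> xs \<in> M" "slot_additive \<omega>"
  shows "CE (CE \<omega>) xs = 0"
  using assms
proof (induction xs arbitrary: \<omega>)
  case (Cons x xs)
  have "CE (CE (\<lambda>ys. \<omega> (x # ys))) xs = 0"
    by (rule Cons.IH) (use Cons.prems slot_additive_Cons in auto)
  then show ?case using Cons.prems(1) Lie_CE[OF Cons.prems]
    by (simp add: CE_diff Lie_mem CE_mem)
qed simp

lemma altform_Lie: "altform sG sV p M \<omega> \<Longrightarrow> altform sG sV p M (Lie x \<omega>)"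
proof (induction p arbitrary: \<omega>)
  case 0
  then have "Lie x \<omega> (y # ys) = 0" for y ys
    by (simp add: altform_0_Cons[OF 0])
  with 0 show ?case by (auto simp: altform_0_iff neq_Nil_conv)
next
  case (Suc p)
  note i = altform_Cons[OF Suc.prems]
  note m = altform_mem[OF Suc.prems]
  show ?case
  proof (rule altform_SucI)
    show "Lie x \<omega> [] = 0" using altformD(2)[OF Suc.prems, of "[]"] by simp
    show "altform sG sV p M (\<lambda>ys. Lie x \<omega> (y # ys))" for y
      by (simp add: altform_diff Suc.IH i)
    show "Lie x \<omega> ((y + z) # bs) = Lie x \<omega> (y # bs) + Lie x \<omega> (z # bs)" for y z bs
      by (simp add: altform_Cons_add[OF Suc.prems] br_add_right Lie_add m)
    have s: "\<omega> (sG c y # bs) = sV c (\<omega> (y # bs))" for c y bs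
      using altformD(4)[OF Suc.prems, of "[]" bs c y] altformD(2)[OF Suc.prems]
      by (cases "length bs = p") auto
    show "Lie x \<omega> (sG c y # bs) = sV c (Lie x \<omega> (y # bs))" for c y bs
      by (simp add: s br_scale_right Lie_scale m scale_right_diff_distrib)
    have z: "\<omega> (y # y # ys) = 0" for y ys
      using altformD(5)[OF Suc.prems, of "[]" "[]" ys y] altformD(2)[OF Suc.prems]
      by (cases "Suc (length ys) = p") auto
    \<comment> \<open>Bracketing either copy of \<open>y\<close> with \<open>x\<close> gives two
      terms that differ by a swap of the first two arguments, so they cancel.\<close>
    show "Lie x \<omega> (y # y # cs) = 0" for y cs
      using altform_swap[OF Suc.prems, of "[]" y "br x y" cs] by (simp add: z)
  qed
qed

lemma Lie_add_left:
  assumes "altform sG sV p M \<omega>"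
  shows "Lie (x + y) \<omega> xs = Lie x \<omega> xs + Lie y \<omega> xs"
  using assms
proof (induction xs arbitrary: \<omega> p)
  case Nil
  then show ?case by (simp add: rho_add_left altform_mem[OF Nil])
next
  case (Cons z zs)
  show ?case
  proof (cases p)
    case 0
    then show ?thesis using altform_0_Cons[of sG sV M \<omega>] Cons.prems by simp
  next
    case (Suc q)
    with Cons.prems have "altform sG sV q M (\<lambda>ys. \<omega> (z # ys))" by (simp add: altform_Cons)
    from Cons.IH[OF this] show ?thesis
      by (simp add: br_add_left altform_Cons_add[OF Cons.prems])
  qed
qed

lemma altform_Cons_scale:
  assumes "altform sG sV p M \<omega>"
  shows "\<omega> (sG c x # bs) = sV c (\<omega> (x # bs))"
  using altformD(2)[OF assms] altformD(4)[OF assms, of "[]"] by (cases "length bs + 1 = p") auto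

lemma Lie_scale_left:
  assumes "altform sG sV p M \<omega>"
  shows "Lie (sG c x) \<omega> xs = sV c (Lie x \<omega> xs)"
  using assms
proof (induction xs arbitrary: \<omega> p)
  case Nil
  then show ?case by (simp add: rho_scale_left altform_mem[OF Nil])
next
  case (Cons z zs)
  show ?case
  proof (cases p)
    case 0
    then show ?thesis using altform_0_Cons[of sG sV M \<omega>] Cons.prems by simp
  next
    case (Suc q)
    with Cons.prems have "altform sG sV q M (\<lambda>ys. \<omega> (z # ys))" by (simp add: altform_Cons)
    from Cons.IH[OF this] show ?thesis
      by (simp add: br_scale_left altform_Cons_scale[OF Cons.prems] scale_right_diff_distrib)
  qed
qed

lemma altform_CE: "altform sG sV p M \<omega> \<Longrightarrow> altform sG sV (Suc p) M (CE \<omega>)"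
proof (induction p arbitrary: \<omega>)
  case 0
  have z: "\<omega> (y # ys) = 0" for y ys by (rule altform_0_Cons[OF 0])
  show ?case
    by (rule altform_SucI)
      (simp_all add: z altform_Lie[OF 0] rho_add_left rho_scale_left altform_mem[OF 0] Lie_add_left[OF 0] Lie_scale_left[OF 0])
next
  case (Suc p)
  note i = altform_Cons[OF Suc.prems]
  note m = altform_mem[OF Suc.prems]
  note s = altform_Cons_scale[OF Suc.prems]
  show ?case
  proof (rule altform_SucI)
    show "altform sG sV (Suc p) M (\<lambda>ys. CE \<omega> (y # ys))" for y
      by (simp add: altform_diff Suc.IH i altform_Lie Suc.prems)
    show "CE \<omega> ((y + z) # bs) = CE \<omega> (y # bs) + CE \<omega> (z # bs)" for y z bs
      by (simp add: altform_Cons_add[OF Suc.prems] Lie_add_left[OF Suc.prems] CE_add m)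
    show "CE \<omega> (sG c y # bs) = sV c (CE \<omega> (y # bs))" for c y bs
      by (simp add: s Lie_scale_left[OF Suc.prems] CE_scale m scale_right_diff_distrib)
    have z: "\<omega> (y # y # ys) = 0" for y ys
      using altformD(5)[OF Suc.prems, of "[]" "[]" ys y] altformD(2)[OF Suc.prems]
      by (cases "Suc (length ys) = p") auto
    \<comment> \<open>The Lie derivative of the contraction by \<open>y\<close> occurs twice with
      opposite signs; what remains contains \<open>br y y\<close> or a repeated
      \<open>y\<close>.\<close>
    show "CE \<omega> (y # y # cs) = 0" for y cs
      by (simp add: z altform_Cons_zero[OF Suc.prems])
  qed simp
qed

lemma Lie_eq_sum:
  assumes "altform sG sV p M \<omega>"
  shows "Lie x \<omega> xs = rho x (\<omega> xs) -
    (\<Sum>j<length xs. sV ((- 1) ^ j) (\<omega> (br x (xs ! j) # del j xs)))"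
  using assms
proof (induction xs arbitrary: \<omega> p)
  case (Cons y ys)
  show ?case
  proof (cases p)
    case 0
    then show ?thesis using altform_0_Cons[of sG sV M \<omega>] Cons.prems by simp
  next
    case (Suc q)
    with Cons.prems have "altform sG sV q M (\<lambda>zs. \<omega> (y # zs))" by (simp add: altform_Cons)
    from Cons.IH[OF this]
    have "Lie x \<omega> (y # ys) = rho x (\<omega> (y # ys)) - (\<omega> (br x y # ys) +
        (\<Sum>j<length ys. sV ((- 1) ^ j) (\<omega> (y # br x (ys ! j) # del j ys))))"
      by simp
    also have "(\<Sum>j<length ys. sV ((- 1) ^ j) (\<omega> (y # br x (ys ! j) # del j ys))) =
        (\<Sum>j<length ys. sV ((- 1) ^ Suc j) (\<omega> (br x (ys ! j) # y # del j ys)))"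
      using altform_swap[OF Cons.prems, of "[]" y] by simp
    finally show ?thesis
      by (simp add: sum.lessThan_Suc_shift del: sum.lessThan_Suc)
  qed
qed simp

text \<open>Links the alternating sum of the definitions to the recursion. The summands with
  \<open>i = 0\<close> form a Lie derivative by \<open>Lie_eq_sum\<close>; those with
  \<open>i > 0\<close> are, after shifting indices and swapping the first argument to the front,
  minus the same sum for the contraction.\<close>

lemma ce_eq_CE:
  assumes "altform sG sV p M \<omega>"
  shows "ce br sV rho p \<omega> xs = CE \<omega> xs"
  using assms
proof (induction p arbitrary: \<omega> xs)
  case 0
  show ?case
  proof (cases "length xs = 1")
    case True
    then obtain x where "xs = [x]" by (auto simp: length_Suc_conv)
    moreover have "{0<..<Suc 0} = {}" by auto
    ultimately show ?thesis by (simp add: ce_def)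
  next
    case False
    then show ?thesis using altformD(2)[OF altform_CE[OF 0]] by (simp add: ce_def)
  qed
next
  case (Suc q)
  show ?case
  proof (cases "length xs = Suc (Suc q)")
    case True
    then obtain x ys where xs: "xs = x # ys" "length ys = Suc q" by (auto simp: length_Suc_conv)
    let ?i = "\<lambda>zs. \<omega> (x # zs)"
    have sh: "(\<Sum>j\<in>{Suc i<..<Suc (Suc q)}. F j) = (\<Sum>j\<in>{i<..<Suc q}. F (Suc j))" for i and F :: "nat \<Rightarrow> 'v"
      by (rule sum.reindex_bij_witness[of _ Suc "\<lambda>j. j - 1"]) auto
    have sh0: "(\<Sum>j\<in>{0<..<Suc (Suc q)}. F j) = (\<Sum>j<Suc q. F (Suc j))" for F :: "nat \<Rightarrow> 'v"
      by (rule sum.reindex_bij_witness[of _ Suc "\<lambda>j. j - 1"]) auto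
    have sw: "\<omega> (u # x # zs) = - \<omega> (x # u # zs)" for u zs
      using altform_swap[OF Suc.prems, of "[]" u x zs] by simp
    have "ce br sV rho (Suc q) \<omega> xs = rho x (\<omega> ys)
       - (\<Sum>j<length ys. sV ((- 1) ^ j) (\<omega> (br x (ys ! j) # del j ys))) - ce br sV rho q ?i ys"
      using xs by (simp add: ce_def sum.lessThan_Suc_shift[of _ "Suc q"] sh sh0 sw sum_negf
          del: sum.lessThan_Suc)
    then show ?thesis
      using Suc.IH[OF altform_Cons[OF Suc.prems]] Lie_eq_sum[OF Suc.prems] by (simp add: xs)
  next
    case False
    then show ?thesis using altformD(2)[OF altform_CE[OF Suc.prems]] by (simp add: ce_def)
  qed
qed

end

text \<open>Bracket terms only rearrange arguments, so \<open>u\<close> passes through them. What is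
  left comes from the action terms: left multiplication by the 1-form measuring how far
  \<open>u\<close> is from being equivariant. It vanishes for equivariant \<open>u\<close> and is
  linear over scalar forms in general.\<close>

lemma CE_comp:
  assumes "lie_rep sG br sV rho M" "lie_rep sG br sW rho' M'"
    and u: "\<And>v. v \<in> M \<Longrightarrow> u v \<in> M'" "\<And>v w. v \<in> M \<Longrightarrow> w \<in> M \<Longrightarrow> u (v - w) = u v - u w"
    and \<omega>: "\<And>xs. \<omega> xs \<in> M"
  shows "ceD br rho' (\<lambda>xs. u (\<omega> xs)) xs =
    u (ceD br rho \<omega> xs) + insD (\<lambda>x v. rho' x (u v) - u (rho x v)) \<omega> xs"
proof -
  interpret V: lie_rep sG br sV rho M by fact
  interpret W: lie_rep sG br sW rho' M' by fact
  have u0: "u 0 = 0" using u(2)[of 0 0] by simp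
  have L: "W.Lie x (\<lambda>xs. u (\<omega> xs)) xs = u (V.Lie x \<omega> xs) + (rho' x (u (\<omega> xs)) - u (rho x (\<omega> xs)))"
    if "\<And>xs. \<omega> xs \<in> M" for x xs \<omega>
    using that by (induction xs arbitrary: \<omega>) (auto simp: u V.Lie_mem)
  show ?thesis using \<omega>
    by (induction xs arbitrary: \<omega>) (auto simp: u0 L u V.Lie_mem V.CE_mem)
qed

section \<open>Coefficient maps linear on a subspace, and the recursive wedge product\<close>

definition linear_sub :: "('k \<Rightarrow> 'v::ab_group_add \<Rightarrow> 'v) \<Rightarrow> ('k \<Rightarrow> 'w::ab_group_add \<Rightarrow> 'w) \<Rightarrow> 'v set \<Rightarrow> 'w set \<Rightarrow> ('v \<Rightarrow> 'w) \<Rightarrow> bool" where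
  "linear_sub sV sW M N u \<longleftrightarrow> (\<forall>v\<in>M. u v \<in> N) \<and>
     (\<forall>v\<in>M. \<forall>w\<in>M. u (v + w) = u v + u w) \<and> (\<forall>c. \<forall>v\<in>M. u (sV c v) = sW c (u v))"

lemma linear_subD:
  assumes "linear_sub sV sW M N u"
  shows "v \<in> M \<Longrightarrow> u v \<in> N" "v \<in> M \<Longrightarrow> w \<in> M \<Longrightarrow> u (v + w) = u v + u w"
    "v \<in> M \<Longrightarrow> u (sV c v) = sW c (u v)" "0 \<in> M \<Longrightarrow> u 0 = 0"
proof -
  show "v \<in> M \<Longrightarrow> u v \<in> N" "v \<in> M \<Longrightarrow> u (sV c v) = sW c (u v)"
    using assms by (auto simp: linear_sub_def)
  show add: "v \<in> M \<Longrightarrow> w \<in> M \<Longrightarrow> u (v + w) = u v + u w" for v w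
    using assms by (auto simp: linear_sub_def)
  show "0 \<in> M \<Longrightarrow> u 0 = 0" using add[of 0 0] by simp
qed

lemma linear_sub_diff:
  assumes "linear_sub sV sW M N u" "vector_space sV" "module.subspace sV M" "v \<in> M" "w \<in> M"
  shows "u (v - w) = u v - u w"
proof -
  interpret vector_space sV by fact
  have "v - w \<in> M" using assms by (simp add: subspace_diff)
  then show ?thesis using linear_subD(2)[OF assms(1), of "v - w" w] assms(5) by simp
qed

lemma altform_comp:
  assumes "linear_sub sV sW M N u" "0 \<in> M" "altform sG sV p M \<omega>"
  shows "altform sG sW p N (\<lambda>xs. u (\<omega> xs))"
  using assms(3) linear_subD[OF assms(1)] assms(2) by (simp add: altform_def)

text \<open>The wedge product, by recursion along the antiderivation property of \<open>\<iota>\<^sub>x\<close>.\<close>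
fun wdg :: "('k::field \<Rightarrow> 'v::ab_group_add \<Rightarrow> 'v) \<Rightarrow> nat \<Rightarrow> ('g list \<Rightarrow> 'k) \<Rightarrow> ('g list \<Rightarrow> 'v) \<Rightarrow> 'g list \<Rightarrow> 'v" where
  "wdg sV a \<alpha> \<omega> [] = sV (\<alpha> []) (\<omega> [])"
| "wdg sV a \<alpha> \<omega> (x # xs) = wdg sV (a - 1) (\<lambda>ys. \<alpha> (x # ys)) \<omega> xs + sV ((- 1) ^ a) (wdg sV a \<alpha> (\<lambda>ys. \<omega> (x # ys)) xs)"

context vector_space
begin

lemma wdg_zero_left [simp]: "wdg scale a (\<lambda>xs. 0) \<omega> xs = 0"
  by (induction xs arbitrary: a \<omega>) auto

lemma wdg_zero_right [simp]: "wdg scale a \<alpha> (\<lambda>xs. 0) xs = 0"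
  by (induction xs arbitrary: a \<alpha>) auto

lemma wdg_diff_right: "wdg scale a \<alpha> (\<lambda>xs. \<omega> xs - \<eta> xs) xs = wdg scale a \<alpha> \<omega> xs - wdg scale a \<alpha> \<eta> xs"
  by (induction xs arbitrary: a \<alpha> \<omega> \<eta>) (auto simp: scale_right_diff_distrib)

lemma wdg_add_right: "wdg scale a \<alpha> (\<lambda>xs. \<omega> xs + \<eta> xs) xs = wdg scale a \<alpha> \<omega> xs + wdg scale a \<alpha> \<eta> xs"
  by (induction xs arbitrary: a \<alpha> \<omega> \<eta>) (auto simp: scale_right_distrib)

lemma wdg_mem: "subspace M \<Longrightarrow> (\<And>xs. \<omega> xs \<in> M) \<Longrightarrow> wdg scale a \<alpha> \<omega> xs \<in> M"
  by (induction xs arbitrary: a \<alpha> \<omega>) (auto simp: subspace_add subspace_scale)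

lemma wdg_comp:
  assumes u: "linear_sub scale sW M N u" and M: "subspace M"
  shows "(\<And>xs. \<omega> xs \<in> M) \<Longrightarrow> u (wdg scale a \<alpha> \<omega> xs) = wdg sW a \<alpha> (\<lambda>xs. u (\<omega> xs)) xs"
  by (induction xs arbitrary: a \<alpha> \<omega>)
    (auto simp: linear_subD[OF u] wdg_mem[OF M] subspace_scale[OF M])

end

text \<open>Both sides obey the recursion \<open>wedge_Cons\<close>. The truncated degree
  \<open>a - 1\<close> at \<open>a = 0\<close> does no harm, since the contraction of a 0-form is
  zero; the same holds for \<open>p\<close>.\<close>

lemma wedge_eq_wdg:
  fixes sV :: "'k::field_char_0 \<Rightarrow> 'v::ab_group_add \<Rightarrow> 'v"
  assumes vs: "vector_space sV"
    and A: "altform sG (*) a UNIV \<alpha>" and W: "altform sG sV p M \<omega>"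
  shows "wedge sV a p \<alpha> \<omega> xs = wdg sV a \<alpha> \<omega> xs"
  using A W
proof (induction xs arbitrary: a p \<alpha> \<omega>)
  case Nil
  interpret vector_space sV by fact
  show ?case
  proof (cases "a + p = 0")
    case True
    moreover have "{\<sigma>. \<sigma> permutes ({} :: nat set)} = {id}" by auto
    ultimately show ?thesis by (simp add: wedge_def permlist_def)
  next
    case False
    then have "\<alpha> [] = 0 \<or> \<omega> [] = 0"
      using altformD(2)[OF Nil(1), of "[]"] altformD(2)[OF Nil(2), of "[]"] by auto
    with False show ?thesis by (auto simp: wedge_def)
  qed
next
  case (Cons x xs)
  interpret vector_space sV by fact
  let ?\<alpha> = "\<lambda>ys. \<alpha> (x # ys)" and ?\<omega> = "\<lambda>ys. \<omega> (x # ys)"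
  have 1: "wdg sV (a - 1) ?\<alpha> \<omega> xs = (if a = 0 then 0 else wedge sV (a - 1) p ?\<alpha> \<omega> xs)"
  proof (cases a)
    case 0
    then have "?\<alpha> = (\<lambda>ys. 0)" using altform_0_Cons Cons.prems(1) by blast
    with 0 show ?thesis by simp
  next
    case (Suc b)
    then have "altform sG (*) b UNIV ?\<alpha>" using altform_Cons Cons.prems(1) by blast
    with Suc Cons show ?thesis by simp
  qed
  have 2: "wdg sV a \<alpha> ?\<omega> xs = (if p = 0 then 0 else wedge sV a (p - 1) \<alpha> ?\<omega> xs)"
  proof (cases p)
    case 0
    then have "?\<omega> = (\<lambda>ys. 0)" using altform_0_Cons Cons.prems(2) by blast
    with 0 show ?thesis by simp
  next
    case (Suc b)
    then have "altform sG sV b M ?\<omega>" using altform_Cons Cons.prems(2) by blast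
    with Suc Cons show ?thesis by simp
  qed
  show ?case
  proof (cases "length xs + 1 = a + p")
    case True
    show ?thesis
      unfolding wedge_Cons[OF vs Cons.prems True] wdg.simps 1 2 by simp
  next
    case False
    then show ?thesis
      unfolding wdg.simps 1 2 by (auto simp: wedge_def)
  qed
qed

lemma insD_zero:
  assumes "\<And>x. \<psi> x 0 = 0"
  shows "insD \<psi> (\<lambda>xs. 0) xs = 0"
  using assms by (induction xs) auto

lemma insD_add_scale:
  assumes "\<And>x. linear_sub sV sV M N (\<psi> x)" "vector_space sV" "module.subspace sV M"
  shows "(\<And>xs. \<omega> xs \<in> M) \<Longrightarrow> (\<And>xs. \<eta> xs \<in> M) \<Longrightarrow>
    insD \<psi> (\<lambda>xs. \<omega> xs + sV c (\<eta> xs)) xs = insD \<psi> \<omega> xs + sV c (insD \<psi> \<eta> xs)"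
proof (induction xs arbitrary: \<omega> \<eta>)
  case Nil
  interpret vector_space sV by fact
  show ?case by simp
next
  case (Cons x xs)
  interpret vector_space sV by fact
  show ?case using Cons
    by (simp add: linear_subD[OF assms(1)] subspace_scale[OF assms(3)] scale_right_diff_distrib)
qed

text \<open>A 1-form with values in linear maps graded-commutes with a scalar form of degree
  \<open>a\<close>. This is what makes the perturbation term of \<open>P\<close> linear over scalar
  forms.\<close>

lemma insD_wdg:
  assumes \<psi>: "\<And>x. linear_sub sV sV M N (\<psi> x)" and vs: "vector_space sV" and M: "module.subspace sV M"
    and A: "altform sG (*) a UNIV \<alpha>" and W: "\<And>xs. \<omega> xs \<in> M"
  shows "insD \<psi> (wdg sV a \<alpha> \<omega>) xs = sV ((- 1) ^ a) (wdg sV a \<alpha> (insD \<psi> \<omega>) xs)"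
  using A W
proof (induction xs arbitrary: a \<alpha> \<omega>)
  case Nil
  interpret vector_space sV by fact
  show ?case by simp
next
  case (Cons x xs)
  interpret vector_space sV by fact
  let ?\<alpha> = "\<lambda>ys. \<alpha> (x # ys)" and ?\<omega> = "\<lambda>ys. \<omega> (x # ys)"
  have e: "insD \<psi> (wdg sV a \<alpha> \<omega>) (x # xs) = wdg sV a \<alpha> (\<lambda>ys. \<psi> x (\<omega> ys)) xs
     - (insD \<psi> (wdg sV (a - 1) ?\<alpha> \<omega>) xs + sV ((- 1) ^ a) (insD \<psi> (wdg sV a \<alpha> ?\<omega>) xs))"
    by (simp add: insD_add_scale[OF \<psi> vs M] wdg_mem[OF M] Cons.prems(2) wdg_comp[OF \<psi> M])
  \<comment> \<open>The contracted \<open>\<alpha>\<close> has degree one less, so the induction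
    hypothesis supplies the opposite sign; for \<open>a = 0\<close> both sides are zero.\<close>
  have 1: "insD \<psi> (wdg sV (a - 1) ?\<alpha> \<omega>) xs = - sV ((- 1) ^ a) (wdg sV (a - 1) ?\<alpha> (insD \<psi> \<omega>) xs)"
  proof (cases a)
    case 0
    then have z: "?\<alpha> = (\<lambda>ys. 0)" using altform_0_Cons Cons.prems(1) by blast
    have "wdg sV (a - 1) (\<lambda>ys. 0) \<omega> = (\<lambda>xs. 0)" by (simp add: fun_eq_iff)
    moreover have "insD \<psi> (\<lambda>xs. 0) xs = 0"
      by (rule insD_zero) (use linear_subD(4)[OF \<psi>] subspace_0[OF M] in auto)
    ultimately show ?thesis unfolding z by simp
  next
    case (Suc b)
    then have "altform sG (*) b UNIV ?\<alpha>" using altform_Cons Cons.prems(1) by blast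
    with Suc Cons show ?thesis by simp
  qed
  have 2: "insD \<psi> (wdg sV a \<alpha> ?\<omega>) xs = sV ((- 1) ^ a) (wdg sV a \<alpha> (insD \<psi> ?\<omega>) xs)"
    by (rule Cons.IH) (use Cons.prems in auto)
  show ?case
    unfolding e 1 2 by (simp add: wdg_diff_right scale_right_distrib scale_right_diff_distrib flip: power_add mult_2)
qed

section \<open>Finite-dimensionality and linear sections\<close>

lemma altform_decompose:
  fixes sG :: "'k::field_char_0 \<Rightarrow> 'g::ab_group_add \<Rightarrow> 'g"
  assumes lie: "lie_algebra sG br" and vs: "vector_space sV" and A: "altform sG sV p M \<omega>"
  obtains B c where "finite B" "B \<subseteq> M" "\<And>b. b \<in> B \<Longrightarrow> altform sG (*) p UNIV (c b)"
    "\<And>xs. \<omega> xs = (\<Sum>b\<in>B. sV (c b xs) b)"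
proof -
  interpret vector_space sV by fact
  interpret G: vector_space sG using lie by (simp add: lie_algebra_def)
  obtain G where G: "finite G" "G.span G = UNIV" using lie by (auto simp: lie_algebra_def)
  define F where "F = \<omega> ` {ys. set ys \<subseteq> G \<and> length ys = p}"
  have F: "finite F" unfolding F_def by (intro finite_imageI finite_lists_length_eq G)
  have FM: "F \<subseteq> M" using altformD(1)[OF A] by (auto simp: F_def)
  \<comment> \<open>The finitely many values on lists from the spanning set \<open>G\<close> already
    span all values. Slots are freed one at a time: entries of \<open>as\<close> stay in
    \<open>G\<close>, entries of \<open>bs\<close> are arbitrary.\<close>
  have sp: "\<omega> (as @ bs) \<in> span F" if "set as \<subseteq> G" "length as + length bs = p" for as bs
    using that
  proof (induction bs arbitrary: as)
    case Nil
    then show ?case by (auto simp: F_def intro!: span_base)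
  next
    case (Cons b bs)
    let ?S = "{x. \<omega> (as @ x # bs) \<in> span F}"
    have l: "length as + length bs + 1 = p" using Cons.prems by simp
    have "b \<in> G.span G" by (simp add: G)
    then have "b \<in> ?S"
    proof (rule G.span_subspace_induct)
      show "G.subspace ?S"
      proof (rule G.subspaceI)
        have "\<omega> (as @ (0 + 0) # bs) = \<omega> (as @ 0 # bs) + \<omega> (as @ 0 # bs)"
          by (rule altformD(3)[OF A l])
        then show "0 \<in> ?S" by (simp add: span_zero)
      qed (auto simp: altformD(3,4)[OF A l] span_add span_scale)
      show "g \<in> ?S" if "g \<in> G" for g
        using Cons.IH[of "as @ [g]"] Cons.prems that by simp
    qed
    then show ?case by simp
  qed
  obtain B where B: "B \<subseteq> F" "independent B" "F \<subseteq> span B"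
    using maximal_independent_subset[of F] by blast
  have spB: "\<omega> xs \<in> span B" for xs
  proof (cases "length xs = p")
    case True
    then have "\<omega> xs \<in> span F" using sp[of "[]" xs] by simp
    then show ?thesis using B(3) span_minimal[OF B(3) subspace_span] by blast
  qed (simp add: altformD(2)[OF A] span_zero)
  have fB: "finite B" using B(1) F finite_subset by blast
  show ?thesis
  \<comment> \<open>The scalar forms are the coordinates of the values of \<open>\<omega>\<close> in
    the basis \<open>B\<close>; they inherit multilinearity and alternation because taking
    coordinates is linear.\<close>
  proof (rule that[of B "\<lambda>b xs. representation B (\<omega> xs) b"])
    show "B \<subseteq> M" using B(1) FM by blast
    show "altform sG (*) p UNIV (\<lambda>xs. representation B (\<omega> xs) b)" for b
      using A spB unfolding altform_def
      by (auto simp: representation_add[OF B(2)] representation_scale[OF B(2)] representation_zero)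
    show "\<omega> xs = (\<Sum>b\<in>B. sV (representation B (\<omega> xs) b) b)" for xs
      using sum_representation_eq[OF B(2) spB fB, of xs] by simp
  qed (fact fB)
qed

lemma linear_section_exists:
  assumes vs: "vector_space sV" and N: "module.subspace sV N" and Z: "module.subspace sV Z"
    and d: "linear_sub sV sV N U d" and surj: "\<And>z. z \<in> Z \<Longrightarrow> \<exists>u\<in>N. d u = z"
  obtains \<sigma> where "linear_sub sV sV UNIV N \<sigma>" "\<And>z. z \<in> Z \<Longrightarrow> d (\<sigma> z) = z"
proof -
  interpret vector_space sV by fact
  interpret P: vector_space_pair sV sV ..
  obtain B where B: "B \<subseteq> Z" "independent B" "Z \<subseteq> span B"
    using maximal_independent_subset[of Z] by blast
  have "\<exists>f. \<forall>z\<in>B. f z \<in> N \<and> d (f z) = z" using surj B(1) by (intro bchoice) blast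
  then obtain f where f: "\<And>z. z \<in> B \<Longrightarrow> f z \<in> N \<and> d (f z) = z" by blast
  \<comment> \<open>Preimages chosen on a basis of \<open>Z\<close> are extended linearly. Fixing
    the range as their span keeps the extension inside \<open>N\<close> on the whole ambient
    space.\<close>
  obtain g where g: "Vector_Spaces.linear sV sV g" "\<forall>x\<in>B. g x = f x" "range g = span (f ` B)"
    using P.linear_independent_extend_subspace[OF B(2), of f] by blast
  interpret g: Vector_Spaces.linear sV sV g by (fact g(1))
  have gN: "g v \<in> N" for v
    using g(3) span_minimal[OF _ N, of "f ` B"] f by blast
  have "d (g z) = z" if "z \<in> span B" for z
    using that
  proof (induction rule: span_induct_alt)
    case base
    then show ?case by (simp add: linear_subD(4)[OF d] subspace_0[OF N])
  next
    case (step c x y)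
    then show ?case
      using g(2) f
      by (simp add: g.add g.scale linear_subD(2,3)[OF d] gN subspace_scale[OF N])
  qed
  moreover have "linear_sub sV sV UNIV N g"
    by (simp add: linear_sub_def gN g.add g.scale)
  ultimately show ?thesis using that B(3) by blast
qed

section \<open>The total complex and \<open>\<Omega>\<close>-linear maps\<close>

lemma insD_eq_zero:
  assumes "\<And>x v. v \<in> M \<Longrightarrow> \<psi> x v = 0"
  shows "(\<And>xs. \<omega> xs \<in> M) \<Longrightarrow> insD \<psi> \<omega> xs = 0"
  using assms by (induction xs arbitrary: \<omega>) auto

text \<open>The component that reaches form degree \<open>p\<close> through an operator raising form
  degree by one. The default zero form at \<open>p = 0\<close> spares a case distinction in
  \<open>dtot_eq\<close> and \<open>P\<close>.\<close>

definition prev :: "(nat \<Rightarrow> 'g list \<Rightarrow> 'v::zero) \<Rightarrow> nat \<Rightarrow> 'g list \<Rightarrow> 'v" where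
  "prev \<xi> p = (if p = 0 then (\<lambda>xs. 0) else \<xi> (p - 1))"

lemma prev_simps [simp]: "prev \<xi> 0 = (\<lambda>xs. 0)" "prev \<xi> (Suc p) = \<xi> p"
  by (simp_all add: prev_def)

context vector_space
begin

lemma scale_sign_twice [simp]: "(- 1) ^ p *s ((- 1) ^ p *s v) = v"
  by (simp flip: power_add mult_2)

end

locale dg_module =
  fixes sG :: "'k::field_char_0 \<Rightarrow> 'g::ab_group_add \<Rightarrow> 'g" and br :: "'g \<Rightarrow> 'g \<Rightarrow> 'g"
    and V :: "('k, 'g, 'v::ab_group_add) dgmod"
  assumes lie: "lie_algebra sG br" and dg: "is_dgmod sG br V"
begin

lemma lie_rep: "lie_rep sG br (scl V) (act V) (carr V i)"
  using lie dg by (simp add: lie_rep_def is_dgmod_def)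

sublocale R: lie_rep sG br "scl V" "act V" "carr V i" for i
  by (rule lie_rep)

abbreviation "CE \<equiv> ceD br (act V)"
abbreviation "d \<equiv> dif V"
abbreviation "dt \<equiv> dtot br V"
abbreviation "Om \<equiv> OmegaV sG V"

lemma dif_linear: "linear_sub (scl V) (scl V) (carr V i) (carr V (i + 1)) (d i)"
  using dg by (simp add: is_dgmod_def linear_sub_def)

lemmas dif_mem [simp] = linear_subD(1)[OF dif_linear]
  and dif_add = linear_subD(2)[OF dif_linear]
  and dif_scale = linear_subD(3)[OF dif_linear]

lemma dif_0 [simp]: "d i 0 = 0"
  using linear_subD(4)[OF dif_linear] by simp

lemma dif_diff: "v \<in> carr V i \<Longrightarrow> w \<in> carr V i \<Longrightarrow> d i (v - w) = d i v - d i w"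
  by (rule linear_sub_diff[OF dif_linear R.vector_space_axioms R.subspace_M])

lemma dif_dif: "v \<in> carr V i \<Longrightarrow> d (i + 1) (d i v) = 0"
  using dg by (simp add: is_dgmod_def)

text \<open>The differential is equivariant, so the 1-form in \<open>CE_comp\<close> is
  zero.\<close>

lemma CE_dif:
  assumes "\<And>xs. \<omega> xs \<in> carr V i"
  shows "CE (\<lambda>xs. d i (\<omega> xs)) xs = d i (CE \<omega> xs)"
proof -
  have "insD (\<lambda>x v. act V x (d i v) - d i (act V x v)) \<omega> xs = 0"
    by (rule insD_eq_zero[of "carr V i"]) (use dg assms in \<open>auto simp: is_dgmod_def\<close>)
  with CE_comp[OF lie_rep lie_rep, of i "d i" "i + 1" \<omega> xs] assms show ?thesis
    by (simp add: dif_diff)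
qed

lemma OmegaV_altform: "Om m \<xi> \<Longrightarrow> altform sG (scl V) p (carr V (m - int p)) (\<xi> p)"
  by (simp add: OmegaV_def)

lemma OmegaV_mem: "Om m \<xi> \<Longrightarrow> \<xi> p xs \<in> carr V (m - int p)"
  by (rule R.altform_mem[OF OmegaV_altform])

lemma OmegaV_prev_mem: "Om m \<xi> \<Longrightarrow> prev \<xi> p xs \<in> carr V (m + 1 - int p)"
  using OmegaV_mem[of m \<xi> "p - 1" xs] by (cases p) auto

lemma dtot_eq:
  assumes "Om m \<xi>"
  shows "dt m \<xi> p xs = CE (prev \<xi> p) xs + scl V ((- 1) ^ p) (d (m - int p) (\<xi> p xs))"
  using R.ce_eq_CE[OF OmegaV_altform[OF assms]] by (cases p) (auto simp: dtot_def)

lemma OmegaV_add: "Om m \<xi> \<Longrightarrow> Om m \<eta> \<Longrightarrow> Om m (\<lambda>p xs. \<xi> p xs + \<eta> p xs)"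
  by (simp add: OmegaV_def R.altform_add)

lemma OmegaV_diff: "Om m \<xi> \<Longrightarrow> Om m \<eta> \<Longrightarrow> Om m (\<lambda>p xs. \<xi> p xs - \<eta> p xs)"
  by (simp add: OmegaV_def R.altform_diff)

lemma OmegaV_zero: "Om m (\<lambda>p xs. 0)"
  by (simp add: OmegaV_def R.altform_zero)

lemma OmegaV_dtot:
  assumes "Om m \<xi>"
  shows "Om (m + 1) (dt m \<xi>)"
proof -
  have "altform sG (scl V) p (carr V (m + 1 - int p)) (dt m \<xi> p)" for p
  proof -
    have i: "m - int p + 1 = m + 1 - int p" by simp
    have 1: "altform sG (scl V) p (carr V (m + 1 - int p)) (\<lambda>xs. CE (prev \<xi> p) xs)"
    proof (cases p)
      case (Suc q)
      then show ?thesis using R.altform_CE[OF OmegaV_altform[OF assms, of q]] by simp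
    qed (simp add: R.altform_zero)
    have 2: "altform sG (scl V) p (carr V (m + 1 - int p)) (\<lambda>xs. d (m - int p) (\<xi> p xs))"
      using altform_comp[OF dif_linear _ OmegaV_altform[OF assms], of p] by (simp add: i)
    show ?thesis
      using R.altform_add[OF 1 R.altform_scale[OF 2]] by (simp add: dtot_eq[OF assms, abs_def])
  qed
  then show ?thesis by (simp add: OmegaV_def)
qed

lemma prev_add: "prev (\<lambda>p xs. \<xi> p xs + (\<eta> p xs :: 'v)) p = (\<lambda>xs. prev \<xi> p xs + prev \<eta> p xs)"
  by (cases p) simp_all

lemma prev_diff: "prev (\<lambda>p xs. \<xi> p xs - (\<eta> p xs :: 'v)) p = (\<lambda>xs. prev \<xi> p xs - prev \<eta> p xs)"
  by (cases p) simp_all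

lemma dtot_add:
  assumes X: "Om m \<xi>" and Y: "Om m \<eta>"
  shows "dt m (\<lambda>p xs. \<xi> p xs + \<eta> p xs) = (\<lambda>p xs. dt m \<xi> p xs + dt m \<eta> p xs)"
proof (intro ext)
  fix p xs
  have "CE (\<lambda>xs. prev \<xi> p xs + prev \<eta> p xs) xs = CE (prev \<xi> p) xs + CE (prev \<eta> p) xs"
    by (rule R.CE_add) (rule OmegaV_prev_mem[OF X] OmegaV_prev_mem[OF Y])+
  moreover have "d (m - int p) (\<xi> p xs + \<eta> p xs) = d (m - int p) (\<xi> p xs) + d (m - int p) (\<eta> p xs)"
    by (rule dif_add) (rule OmegaV_mem[OF X] OmegaV_mem[OF Y])+
  ultimately show "dt m (\<lambda>p xs. \<xi> p xs + \<eta> p xs) p xs = dt m \<xi> p xs + dt m \<eta> p xs"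
    by (simp only: dtot_eq[OF OmegaV_add[OF X Y]] dtot_eq[OF X] dtot_eq[OF Y] prev_add R.scale_right_distrib) simp
qed

lemma dtot_diff:
  assumes X: "Om m \<xi>" and Y: "Om m \<eta>"
  shows "dt m (\<lambda>p xs. \<xi> p xs - \<eta> p xs) = (\<lambda>p xs. dt m \<xi> p xs - dt m \<eta> p xs)"
proof (intro ext)
  fix p xs
  have "CE (\<lambda>xs. prev \<xi> p xs - prev \<eta> p xs) xs = CE (prev \<xi> p) xs - CE (prev \<eta> p) xs"
    by (rule R.CE_diff) (rule OmegaV_prev_mem[OF X] OmegaV_prev_mem[OF Y])+
  moreover have "d (m - int p) (\<xi> p xs - \<eta> p xs) = d (m - int p) (\<xi> p xs) - d (m - int p) (\<eta> p xs)"
    by (rule dif_diff) (rule OmegaV_mem[OF X] OmegaV_mem[OF Y])+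
  ultimately show "dt m (\<lambda>p xs. \<xi> p xs - \<eta> p xs) p xs = dt m \<xi> p xs - dt m \<eta> p xs"
    by (simp only: dtot_eq[OF OmegaV_diff[OF X Y]] dtot_eq[OF X] dtot_eq[OF Y] prev_diff R.scale_right_diff_distrib) simp
qed

text \<open>\<open>CE\<close> and the internal differential each square to zero and commute with
  each other. The sign \<open>(- 1) ^ p\<close> changes between consecutive form degrees, so the two
  mixed terms cancel.\<close>

lemma dtot_dtot:
  assumes O: "Om m \<xi>"
  shows "dt (m + 1) (dt m \<xi>) = (\<lambda>p xs. 0)"
proof (intro ext)
  fix p xs
  note O' = OmegaV_dtot[OF O]
  note mem = OmegaV_mem[OF O]
  show "dt (m + 1) (dt m \<xi>) p xs = 0"
  proof (cases p)
    case 0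
    show ?thesis using dif_dif[OF mem[of 0 xs]] by (simp add: dtot_eq[OF O'] dtot_eq[OF O] 0)
  next
    case (Suc q)
    have i: "m + 1 - int p = m - int q" "m - int p + 1 = m - int q" "m - int q + 1 = m + 1 - int q"
      using Suc by auto
    have pm: "CE (prev \<xi> q) ys \<in> carr V (m + 1 - int q)" for ys
      by (rule R.CE_mem) (rule OmegaV_prev_mem[OF O])
    have dm: "d (m - int q) (\<xi> q ys) \<in> carr V (m + 1 - int q)" for ys
      using dif_mem[OF mem[of q ys]] by (simp add: i)
    have cm: "CE (\<xi> q) xs \<in> carr V (m - int q)"
      by (rule R.CE_mem) (rule mem)
    have dm': "d (m - int p) (\<xi> p xs) \<in> carr V (m - int q)"
      using dif_mem[OF mem[of p xs]] by (simp add: i)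
    have sl: "slot_additive (prev \<xi> q)"
      using altform_slot_additive[OF OmegaV_altform[OF O, of "q - 1"]]
      by (cases q) (auto simp: slot_additive_def)
    have z: "d (m - int q) (d (m - int p) (\<xi> p xs)) = 0"
      using dif_dif[OF mem[of p xs]] by (simp only: i)
    have "dt m \<xi> q = (\<lambda>ys. CE (prev \<xi> q) ys + scl V ((- 1) ^ q) (d (m - int q) (\<xi> q ys)))"
      by (simp add: dtot_eq[OF O, abs_def])
    then have "CE (prev (dt m \<xi>) p) xs = CE (CE (prev \<xi> q)) xs + scl V ((- 1) ^ q) (CE (\<lambda>ys. d (m - int q) (\<xi> q ys)) xs)"
      using Suc by (simp add: R.CE_add[of _ "m + 1 - int q"] R.CE_scale[of _ "m + 1 - int q"] pm dm)
    also have "CE (CE (prev \<xi> q)) xs = 0"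
      by (rule R.CE_CE[of _ "m + 1 - int q"]) (rule OmegaV_prev_mem[OF O], rule sl)
    also have "CE (\<lambda>ys. d (m - int q) (\<xi> q ys)) xs = d (m - int q) (CE (\<xi> q) xs)"
      by (rule CE_dif) (rule mem)
    finally have 1: "CE (prev (dt m \<xi>) p) xs = scl V ((- 1) ^ q) (d (m - int q) (CE (\<xi> q) xs))" by simp
    have "d (m - int q) (dt m \<xi> p xs) =
        d (m - int q) (CE (\<xi> q) xs + scl V ((- 1) ^ p) (d (m - int p) (\<xi> p xs)))"
      by (simp only: dtot_eq[OF O] Suc prev_simps)
    also have "\<dots> = d (m - int q) (CE (\<xi> q) xs)"
      using cm dm' by (simp add: dif_add dif_scale z)
    finally have "dt (m + 1) (dt m \<xi>) p xs = scl V ((- 1) ^ q) (d (m - int q) (CE (\<xi> q) xs))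
        + scl V ((- 1) ^ p) (d (m - int q) (CE (\<xi> q) xs))"
      by (simp only: dtot_eq[OF O'] 1 i)
    then show ?thesis by (simp add: Suc)
  qed
qed

end

section \<open>Maps linear over scalar forms\<close>

lemma wedgeO_add:
  assumes "vector_space sV"
  shows "wedgeO sV a \<alpha> (\<lambda>p xs. \<xi> p xs + \<eta> p xs) p xs = wedgeO sV a \<alpha> \<xi> p xs + wedgeO sV a \<alpha> \<eta> p xs"
proof -
  interpret vector_space sV by fact
  show ?thesis by (simp add: wedgeO_def wedge_def scale_right_distrib sum.distrib)
qed

lemma wedgeO_diff:
  assumes "vector_space sV"
  shows "wedgeO sV a \<alpha> (\<lambda>p xs. \<xi> p xs - \<eta> p xs) p xs = wedgeO sV a \<alpha> \<xi> p xs - wedgeO sV a \<alpha> \<eta> p xs"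
proof -
  interpret vector_space sV by fact
  show ?thesis by (simp add: wedgeO_def wedge_def scale_right_diff_distrib sum_subtractf)
qed

lemma wedgeO_scale:
  assumes "vector_space sV"
  shows "wedgeO sV a (\<lambda>xs. c * \<alpha> xs) \<xi> p xs = sV c (wedgeO sV a \<alpha> \<xi> p xs)"
proof -
  interpret vector_space sV by fact
  show ?thesis by (simp add: wedgeO_def wedge_def scale_sum_right ac_simps)
qed

text \<open>Degree \<open>-k\<close> with the Koszul sign. The value \<open>k = 0\<close> gives weak
  morphisms apart from compatibility with \<open>dtot\<close>, and \<open>k = 1\<close> gives the
  linearity conditions on a homotopy.\<close>

definition omega_linear :: "('k::field_char_0 \<Rightarrow> 'g::ab_group_add \<Rightarrow> 'g) \<Rightarrow>
    ('k, 'g, 'v::ab_group_add) dgmod \<Rightarrow> ('k, 'g, 'w::ab_group_add) dgmod \<Rightarrow> nat \<Rightarrow>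
    (int \<Rightarrow> (nat \<Rightarrow> 'g list \<Rightarrow> 'v) \<Rightarrow> (nat \<Rightarrow> 'g list \<Rightarrow> 'w)) \<Rightarrow> bool" where
  "omega_linear sG V W k f \<longleftrightarrow>
     (\<forall>m \<xi>. OmegaV sG V m \<xi> \<longrightarrow> OmegaV sG W (m - int k) (f m \<xi>)) \<and>
     (\<forall>m \<xi> \<eta>. OmegaV sG V m \<xi> \<longrightarrow> OmegaV sG V m \<eta> \<longrightarrow>
        f m (\<lambda>p xs. \<xi> p xs + \<eta> p xs) = (\<lambda>p xs. f m \<xi> p xs + f m \<eta> p xs)) \<and>
     (\<forall>m a \<alpha> \<xi>. altform sG (*) a UNIV \<alpha> \<longrightarrow> OmegaV sG V m \<xi> \<longrightarrow>
        f (m + int a) (wedgeO (scl V) a \<alpha> \<xi>) =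
        (\<lambda>p xs. scl W ((-1) ^ (k * a)) (wedgeO (scl W) a \<alpha> (f m \<xi>) p xs)))"

lemma omega_linearD:
  assumes "omega_linear sG V W k f"
  shows "OmegaV sG V m \<xi> \<Longrightarrow> OmegaV sG W (m - int k) (f m \<xi>)"
    "OmegaV sG V m \<xi> \<Longrightarrow> OmegaV sG V m \<eta> \<Longrightarrow>
        f m (\<lambda>p xs. \<xi> p xs + \<eta> p xs) = (\<lambda>p xs. f m \<xi> p xs + f m \<eta> p xs)"
    "altform sG (*) a UNIV \<alpha> \<Longrightarrow> OmegaV sG V m \<xi> \<Longrightarrow>
        f (m + int a) (wedgeO (scl V) a \<alpha> \<xi>) =
        (\<lambda>p xs. scl W ((-1) ^ (k * a)) (wedgeO (scl W) a \<alpha> (f m \<xi>) p xs))"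
  using assms by (auto simp: omega_linear_def)

text \<open>The Koszul sign of \<open>f\<close> is absorbed into the scalar form, so that linearity
  of \<open>g\<close> applies to an honest wedge product; the two signs then multiply.\<close>

lemma omega_linear_comp:
  assumes f: "omega_linear sG U V k f" and g: "omega_linear sG V W l g"
    and vs: "vector_space (scl V)" "vector_space (scl W)"
  shows "omega_linear sG U W (k + l) (\<lambda>m \<xi>. g (m - int k) (f m \<xi>))"
  unfolding omega_linear_def
proof (intro conjI allI impI)
  fix m \<xi> assume X: "OmegaV sG U m \<xi>"
  show "OmegaV sG W (m - int (k + l)) (g (m - int k) (f m \<xi>))"
    using omega_linearD(1)[OF g omega_linearD(1)[OF f X]] by (simp add: algebra_simps)
  fix \<eta> assume "OmegaV sG U m \<eta>"
  then show "g (m - int k) (f m (\<lambda>p xs. \<xi> p xs + \<eta> p xs)) =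
     (\<lambda>p xs. g (m - int k) (f m \<xi>) p xs + g (m - int k) (f m \<eta>) p xs)"
    by (simp add: omega_linearD(2)[OF f] omega_linearD(2)[OF g] omega_linearD(1)[OF f] X)
next
  fix m a \<alpha> \<xi> assume A: "altform sG (*) a UNIV (\<alpha> :: 'b list \<Rightarrow> 'a)" and X: "OmegaV sG U m \<xi>"
  interpret W: vector_space "scl W" by fact
  let ?c = "(- 1 :: 'a) ^ (k * a)"
  have "altform sG (*) a UNIV (\<lambda>xs. ?c * \<alpha> xs)"
    using A by (simp add: altform_def algebra_simps)
  note gg = omega_linearD(3)[OF g this omega_linearD(1)[OF f X]]
  have i: "m + int a - int k = m - int k + int a" by simp
  have "f (m + int a) (wedgeO (scl U) a \<alpha> \<xi>) = wedgeO (scl V) a (\<lambda>xs. ?c * \<alpha> xs) (f m \<xi>)"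
    by (simp add: omega_linearD(3)[OF f A X] wedgeO_scale[OF vs(1), abs_def])
  moreover have "(- 1 :: 'a) ^ (l * a) * ?c = (- 1) ^ ((k + l) * a)"
    by (simp add: algebra_simps flip: power_add)
  ultimately show "g (m + int a - int k) (f (m + int a) (wedgeO (scl U) a \<alpha> \<xi>)) =
     (\<lambda>p xs. scl W ((- 1) ^ ((k + l) * a)) (wedgeO (scl W) a \<alpha> (g (m - int k) (f m \<xi>)) p xs))"
    unfolding i by (simp add: gg wedgeO_scale[OF vs(2)])
qed

lemma omega_linear_add:
  assumes f: "omega_linear sG V W k f" and g: "omega_linear sG V W k g"
    and "dg_module sG br W"
  shows "omega_linear sG V W k (\<lambda>m \<xi> p xs. f m \<xi> p xs + g m \<xi> p xs)"
proof -
  interpret W: dg_module sG br W by fact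
  show ?thesis
    unfolding omega_linear_def
  proof (intro conjI allI impI)
    fix m \<xi> assume X: "OmegaV sG V m \<xi>"
    show "OmegaV sG W (m - int k) (\<lambda>p xs. f m \<xi> p xs + g m \<xi> p xs)"
      by (intro W.OmegaV_add omega_linearD(1)[OF f X] omega_linearD(1)[OF g X])
    fix \<eta> assume Y: "OmegaV sG V m \<eta>"
    show "(\<lambda>p xs. f m (\<lambda>p xs. \<xi> p xs + \<eta> p xs) p xs + g m (\<lambda>p xs. \<xi> p xs + \<eta> p xs) p xs) =
      (\<lambda>p xs. (f m \<xi> p xs + g m \<xi> p xs) + (f m \<eta> p xs + g m \<eta> p xs))"
      unfolding omega_linearD(2)[OF f X Y] omega_linearD(2)[OF g X Y] by (intro ext) simp
  next
    fix m a \<alpha> \<xi> assume A: "altform sG (*) a UNIV (\<alpha> :: 'b list \<Rightarrow> 'a)" and X: "OmegaV sG V m \<xi>"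
    show "(\<lambda>p xs. f (m + int a) (wedgeO (scl V) a \<alpha> \<xi>) p xs + g (m + int a) (wedgeO (scl V) a \<alpha> \<xi>) p xs) =
      (\<lambda>p xs. scl W ((- 1) ^ (k * a)) (wedgeO (scl W) a \<alpha> (\<lambda>p xs. f m \<xi> p xs + g m \<xi> p xs) p xs))"
      unfolding omega_linearD(3)[OF f A X] omega_linearD(3)[OF g A X] wedgeO_add[OF W.R.vector_space_axioms]
        W.R.scale_right_distrib ..
  qed
qed

lemma omega_linear_diff:
  assumes f: "omega_linear sG V W k f" and g: "omega_linear sG V W k g"
    and "dg_module sG br W"
  shows "omega_linear sG V W k (\<lambda>m \<xi> p xs. f m \<xi> p xs - g m \<xi> p xs)"
proof -
  interpret W: dg_module sG br W by fact
  show ?thesis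
    unfolding omega_linear_def
  proof (intro conjI allI impI)
    fix m \<xi> assume X: "OmegaV sG V m \<xi>"
    show "OmegaV sG W (m - int k) (\<lambda>p xs. f m \<xi> p xs - g m \<xi> p xs)"
      by (intro W.OmegaV_diff omega_linearD(1)[OF f X] omega_linearD(1)[OF g X])
    fix \<eta> assume Y: "OmegaV sG V m \<eta>"
    show "(\<lambda>p xs. f m (\<lambda>p xs. \<xi> p xs + \<eta> p xs) p xs - g m (\<lambda>p xs. \<xi> p xs + \<eta> p xs) p xs) =
      (\<lambda>p xs. (f m \<xi> p xs - g m \<xi> p xs) + (f m \<eta> p xs - g m \<eta> p xs))"
      unfolding omega_linearD(2)[OF f X Y] omega_linearD(2)[OF g X Y] by (intro ext) simp
  next
    fix m a \<alpha> \<xi> assume A: "altform sG (*) a UNIV (\<alpha> :: 'b list \<Rightarrow> 'a)" and X: "OmegaV sG V m \<xi>"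
    show "(\<lambda>p xs. f (m + int a) (wedgeO (scl V) a \<alpha> \<xi>) p xs - g (m + int a) (wedgeO (scl V) a \<alpha> \<xi>) p xs) =
      (\<lambda>p xs. scl W ((- 1) ^ (k * a)) (wedgeO (scl W) a \<alpha> (\<lambda>p xs. f m \<xi> p xs - g m \<xi> p xs) p xs))"
      unfolding omega_linearD(3)[OF f A X] omega_linearD(3)[OF g A X] wedgeO_diff[OF W.R.vector_space_axioms]
        W.R.scale_right_diff_distrib ..
  qed
qed

lemma weak_morph_iff:
  assumes "dg_module sG br W"
  shows "weak_morph sG br V W f \<longleftrightarrow> omega_linear sG V W 0 f \<and>
    (\<forall>m \<xi>. OmegaV sG V m \<xi> \<longrightarrow> f (m + 1) (dtot br V m \<xi>) = dtot br W m (f m \<xi>))"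
proof -
  interpret W: dg_module sG br W by fact
  show ?thesis by (auto simp: weak_morph_def omega_linear_def)
qed

section \<open>The perturbed projection\<close>

text \<open>The data extracted from a resolution: linear maps \<open>s\<close> of degree -1, with no
  equivariance demanded, that contract the complex in degrees 1 and above. In degree 0 the target of
  \<open>s\<close> is zero.\<close>

locale contracted = dg_module sG br V for sG :: "'k::field_char_0 \<Rightarrow> 'g::ab_group_add \<Rightarrow> 'g" and br
    and V :: "('k, 'g, 'v::ab_group_add) dgmod" +
  fixes s :: "int \<Rightarrow> 'v \<Rightarrow> 'v"
  assumes nonneg: "nonneg V"
    and s_linear: "linear_sub (scl V) (scl V) (carr V i) (carr V (i - 1)) (s i)"
    and s_homotopy: "1 \<le> i \<Longrightarrow> v \<in> carr V i \<Longrightarrow> d (i - 1) (s i v) + s (i + 1) (d i v) = v"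
begin

lemma carr_neg: "v \<in> carr V i \<Longrightarrow> i < 0 \<Longrightarrow> v = 0"
  using nonneg by (auto simp: nonneg_def)

lemmas s_mem [simp] = linear_subD(1)[OF s_linear]
  and s_add = linear_subD(2)[OF s_linear]
  and s_scale = linear_subD(3)[OF s_linear]

lemma s_0 [simp]: "s i 0 = 0"
  using linear_subD(4)[OF s_linear] by simp

lemma s_diff: "v \<in> carr V i \<Longrightarrow> w \<in> carr V i \<Longrightarrow> s i (v - w) = s i v - s i w"
  by (rule linear_sub_diff[OF s_linear R.vector_space_axioms R.subspace_M])

text \<open>The defect of the contraction. It vanishes away from degree 0, and in degree 0 it is a
  projection onto \<open>kerd0 V\<close>.\<close>

definition proj :: "int \<Rightarrow> 'v \<Rightarrow> 'v" where
  "proj i v = v - d (i - 1) (s i v) - s (i + 1) (d i v)"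

text \<open>The failure of \<open>s\<close> to be equivariant, that is, the 1-form produced by
  \<open>CE_comp\<close> for \<open>u = s i\<close>.\<close>

definition comm :: "int \<Rightarrow> 'g \<Rightarrow> 'v \<Rightarrow> 'v" where
  "comm i x v = act V x (s i v) - s i (act V x v)"

lemma ds_mem [simp]: "v \<in> carr V i \<Longrightarrow> d (i - 1) (s i v) \<in> carr V i"
  using dif_mem[OF s_mem, of v i] by simp

lemma sd_mem [simp]: "v \<in> carr V i \<Longrightarrow> s (i + 1) (d i v) \<in> carr V i"
  using s_mem[OF dif_mem, of v i] by simp

lemma proj_linear: "linear_sub (scl V) (scl V) (carr V i) (carr V i) (proj i)"
  unfolding linear_sub_def proj_def
  by (simp add: s_add s_scale dif_add dif_scale R.scale_right_diff_distrib)

lemma comm_linear: "linear_sub (scl V) (scl V) (carr V i) (carr V (i - 1)) (comm i x)"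
  unfolding linear_sub_def comm_def
  by (simp add: s_add s_scale R.rho_add[of _ i] R.rho_add[of _ "i - 1"] R.rho_scale[of _ i]
      R.rho_scale[of _ "i - 1"] R.scale_right_diff_distrib)

lemma insD_comm_zero: "insD (comm i) (\<lambda>xs. 0) xs = 0"
  by (rule insD_zero) (rule linear_subD(4)[OF comm_linear], simp)

lemma proj_nonzero: "i \<noteq> 0 \<Longrightarrow> v \<in> carr V i \<Longrightarrow> proj i v = 0"
  using s_homotopy[of i v] carr_neg[of v i] by (cases "i < 0") (auto simp: proj_def algebra_simps)

lemma s_degree_0: "v \<in> carr V 0 \<Longrightarrow> s 0 v = 0"
  using carr_neg[OF s_mem[of v 0]] by simp

text \<open>The homotopy identity in degree 1, applied to the cocycle \<open>d 0 v\<close>, says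
  that \<open>s 1 (d 0 v)\<close> has the same differential as \<open>v\<close>.\<close>

lemma proj_0_kerd0: "v \<in> carr V 0 \<Longrightarrow> proj 0 v \<in> kerd0 V"
proof -
  assume v: "v \<in> carr V 0"
  have dv: "d 0 v \<in> carr V 1" using dif_mem[OF v] by simp
  have "d 0 (s 1 (d 0 v)) = d 0 v"
    using s_homotopy[OF _ dv] dif_dif[OF v] by simp
  moreover have "s 1 (d 0 v) \<in> carr V 0" using s_mem[OF dv] by simp
  ultimately show ?thesis using v by (simp add: proj_def kerd0_def s_degree_0 dif_diff)
qed

lemma proj_0_id: "v \<in> kerd0 V \<Longrightarrow> proj 0 v = v"
  by (simp add: proj_def kerd0_def s_degree_0)

text \<open>The sign is the one for moving the odd map \<open>s\<close> past a
  \<open>p\<close>-form.\<close>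

definition S :: "int \<Rightarrow> (nat \<Rightarrow> 'g list \<Rightarrow> 'v) \<Rightarrow> nat \<Rightarrow> 'g list \<Rightarrow> 'v" where
  "S m \<xi> = (\<lambda>p xs. scl V ((- 1) ^ p) (s (m - int p) (\<xi> p xs)))"

text \<open>Written by components and without \<open>CE\<close>, so that linearity over scalar forms
  and the drop in coefficient degree can be read off. \<open>P_eq\<close> shows that it is the
  identity minus the homotopy terms of \<open>S\<close>.\<close>

definition P :: "int \<Rightarrow> (nat \<Rightarrow> 'g list \<Rightarrow> 'v) \<Rightarrow> nat \<Rightarrow> 'g list \<Rightarrow> 'v" where
  "P m \<xi> = (\<lambda>p xs. proj (m - int p) (\<xi> p xs) + scl V ((- 1) ^ p) (insD (comm (m + 1 - int p)) (prev \<xi> p) xs))"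

lemma OmegaV_S:
  assumes "Om m \<xi>"
  shows "Om (m - 1) (S m \<xi>)"
proof -
  have "altform sG (scl V) p (carr V (m - 1 - int p)) (S m \<xi> p)" for p
  proof -
    have i: "m - int p - 1 = m - 1 - int p" by simp
    have "altform sG (scl V) p (carr V (m - int p - 1)) (\<lambda>xs. s (m - int p) (\<xi> p xs))"
      by (rule altform_comp[OF s_linear _ OmegaV_altform[OF assms]]) simp
    from R.altform_scale[OF this] show ?thesis by (simp only: S_def i)
  qed
  then show ?thesis by (simp add: OmegaV_def)
qed

lemma S_add:
  assumes "Om m \<xi>" "Om m \<eta>"
  shows "S m (\<lambda>p xs. \<xi> p xs + \<eta> p xs) = (\<lambda>p xs. S m \<xi> p xs + S m \<eta> p xs)"
  by (simp add: S_def s_add OmegaV_mem[OF assms(1)] OmegaV_mem[OF assms(2)] R.scale_right_distrib)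

lemma S_zero: "S m (\<lambda>p xs. 0) = (\<lambda>p xs. 0)"
  by (simp add: S_def)

text \<open>Moving \<open>CE\<close> past \<open>s\<close> by \<open>CE_comp\<close> gives
  \<open>s\<close> after \<open>CE\<close> plus a \<open>comm\<close> term. The terms with
  \<open>s\<close> after \<open>CE\<close> from the two composites have opposite signs and cancel,
  which leaves \<open>proj\<close> and \<open>comm\<close>.\<close>

lemma P_eq:
  assumes O: "Om m \<xi>"
  shows "P m \<xi> = (\<lambda>p xs. \<xi> p xs - dt (m - 1) (S m \<xi>) p xs - S (m + 1) (dt m \<xi>) p xs)"
proof (intro ext)
  fix p xs
  note mem = OmegaV_mem[OF O]
  define v where "v = \<xi> p xs"
  define i where "i = m - int p"
  have v: "v \<in> carr V i" using mem by (simp add: v_def i_def)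
  define c where "c = CE (prev \<xi> p) xs"
  have c: "c \<in> carr V (i + 1)"
    using R.CE_mem[of "prev \<xi> p" "m + 1 - int p" xs] OmegaV_prev_mem[OF O, of p]
    by (simp add: c_def i_def algebra_simps)
  have i1: "m + 1 - int p = i + 1" "m - int p = i" "m - 1 - int p = i - 1" by (simp_all add: i_def)
  \<comment> \<open>The minus sign appears because the component of \<open>S\<close> that enters
    here has form degree \<open>p - 1\<close>.\<close>
  have "CE (prev (S m \<xi>) p) xs = - scl V ((- 1) ^ p) (s (i + 1) c + insD (comm (i + 1)) (prev \<xi> p) xs)"
  proof (cases p)
    case 0
    then show ?thesis by (simp add: c_def insD_comm_zero)
  next
    case (Suc q)
    have iq: "m - int q = i + 1" using Suc by (simp add: i_def)
    have mq: "\<xi> q xs \<in> carr V (i + 1)" for xs using mem[of q xs] by (simp only: iq)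
    have sm: "s (i + 1) (\<xi> q xs) \<in> carr V i" for xs using s_mem[OF mq] by simp
    have "CE (prev (S m \<xi>) p) xs = CE (\<lambda>xs. scl V ((- 1) ^ q) (s (i + 1) (\<xi> q xs))) xs"
      by (simp add: Suc S_def iq)
    also have "\<dots> = scl V ((- 1) ^ q) (CE (\<lambda>xs. s (i + 1) (\<xi> q xs)) xs)"
      by (rule R.CE_scale) (rule sm)
    also have "CE (\<lambda>xs. s (i + 1) (\<xi> q xs)) xs = s (i + 1) (CE (\<xi> q) xs) + insD (comm (i + 1)) (\<xi> q) xs"
      unfolding comm_def
      by (rule CE_comp[OF lie_rep[of "i + 1"] lie_rep[of i]])
        (use s_mem[of _ "i + 1"] s_diff[of _ "i + 1"] mq in auto)
    finally show ?thesis by (simp add: Suc c_def)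
  qed
  moreover have "d (i - 1) (S m \<xi> p xs) = scl V ((- 1) ^ p) (d (i - 1) (s i v))"
    using v by (simp add: S_def i1 dif_scale v_def)
  ultimately have 1: "dt (m - 1) (S m \<xi>) p xs =
      d (i - 1) (s i v) - scl V ((- 1) ^ p) (s (i + 1) c + insD (comm (i + 1)) (prev \<xi> p) xs)"
    by (simp add: dtot_eq[OF OmegaV_S[OF O]] i1)
  have "S (m + 1) (dt m \<xi>) p xs = scl V ((- 1) ^ p) (s (i + 1) (c + scl V ((- 1) ^ p) (d i v)))"
    by (simp add: S_def dtot_eq[OF O] i1 v_def c_def)
  also have "\<dots> = scl V ((- 1) ^ p) (s (i + 1) c) + s (i + 1) (d i v)"
    using c v by (simp add: s_add s_scale R.scale_right_distrib)
  finally have 2: "S (m + 1) (dt m \<xi>) p xs = scl V ((- 1) ^ p) (s (i + 1) c) + s (i + 1) (d i v)" .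
  show "P m \<xi> p xs = \<xi> p xs - dt (m - 1) (S m \<xi>) p xs - S (m + 1) (dt m \<xi>) p xs"
    unfolding 1 2 by (simp add: P_def i1 proj_def R.scale_right_distrib flip: v_def)
qed

lemma OmegaV_dS: "Om m \<xi> \<Longrightarrow> Om m (dt (m - 1) (S m \<xi>))"
  using OmegaV_dtot[OF OmegaV_S, of m \<xi>] by simp

lemma OmegaV_Sd: "Om m \<xi> \<Longrightarrow> Om m (S (m + 1) (dt m \<xi>))"
  using OmegaV_S[OF OmegaV_dtot, of m \<xi>] by simp

lemma OmegaV_P: "Om m \<xi> \<Longrightarrow> Om m (P m \<xi>)"
  by (subst P_eq, assumption) (intro OmegaV_diff OmegaV_dS OmegaV_Sd)

text \<open>As \<open>dtot\<close> squares to zero, both sides reduce to \<open>dtot\<close> minus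
  the composite of \<open>dtot\<close>, \<open>S\<close> and \<open>dtot\<close>.\<close>

lemma P_dtot:
  assumes O: "Om m \<xi>"
  shows "P (m + 1) (dt m \<xi>) = dt m (P m \<xi>)"
proof -
  have 1: "dt m (dt (m - 1) (S m \<xi>)) = (\<lambda>p xs. 0)"
    using dtot_dtot[OF OmegaV_S[OF O]] by simp
  have "dt m (P m \<xi>) = (\<lambda>p xs. dt m \<xi> p xs - dt m (S (m + 1) (dt m \<xi>)) p xs)"
    unfolding P_eq[OF O]
    by (subst dtot_diff, intro OmegaV_diff O OmegaV_dS, intro OmegaV_Sd O)
      (simp add: dtot_diff[OF O OmegaV_dS[OF O]] 1)
  moreover have "P (m + 1) (dt m \<xi>) = (\<lambda>p xs. dt m \<xi> p xs - dt m (S (m + 1) (dt m \<xi>)) p xs)"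
    using P_eq[OF OmegaV_dtot[OF O]] by (simp add: dtot_dtot[OF O] S_zero)
  ultimately show ?thesis by simp
qed

lemma wedgeO_wdg:
  assumes A: "altform sG (*) a UNIV \<alpha>" and O: "Om m \<xi>" and "a \<le> p"
  shows "wedgeO (scl V) a \<alpha> \<xi> p xs = wdg (scl V) a \<alpha> (\<xi> (p - a)) xs"
  using assms by (simp add: wedgeO_def wedge_eq_wdg[OF R.vector_space_axioms A OmegaV_altform[OF O]])

lemma S_linear: "omega_linear sG V V 1 S"
  unfolding omega_linear_def
proof (intro conjI allI impI)
  fix m \<xi> assume O: "Om m \<xi>"
  show "Om (m - int 1) (S m \<xi>)" using OmegaV_S[OF O] by simp
  fix \<eta> assume "Om m \<eta>"
  then show "S m (\<lambda>p xs. \<xi> p xs + \<eta> p xs) = (\<lambda>p xs. S m \<xi> p xs + S m \<eta> p xs)"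
    using S_add O by blast
next
  fix m a \<alpha> \<xi> assume A: "altform sG (*) a UNIV (\<alpha> :: 'g list \<Rightarrow> 'k)" and O: "Om m \<xi>"
  show "S (m + int a) (wedgeO (scl V) a \<alpha> \<xi>) =
    (\<lambda>p xs. scl V ((- 1) ^ (1 * a)) (wedgeO (scl V) a \<alpha> (S m \<xi>) p xs))"
  proof (intro ext)
    fix p xs
    show "S (m + int a) (wedgeO (scl V) a \<alpha> \<xi>) p xs = scl V ((- 1) ^ (1 * a)) (wedgeO (scl V) a \<alpha> (S m \<xi>) p xs)"
    proof (cases "a \<le> p")
      case True
      then obtain q where q: "p = a + q" by (auto simp: le_iff_add)
      have i: "m + int a - int p = m - int q" by (simp add: q)
      have sc: "linear_sub (scl V) (scl V) UNIV UNIV (scl V ((- 1) ^ q))"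
        by (simp add: linear_sub_def R.scale_right_distrib mult.commute)
      have "S (m + int a) (wedgeO (scl V) a \<alpha> \<xi>) p xs =
          scl V ((- 1) ^ p) (s (m - int q) (wdg (scl V) a \<alpha> (\<xi> q) xs))"
        using True by (simp add: S_def wedgeO_wdg[OF A O] i q)
      also have "s (m - int q) (wdg (scl V) a \<alpha> (\<xi> q) xs) = wdg (scl V) a \<alpha> (\<lambda>xs. s (m - int q) (\<xi> q xs)) xs"
        by (rule R.wdg_comp[OF s_linear R.subspace_M]) (rule OmegaV_mem[OF O])
      also have "scl V ((- 1) ^ p) \<dots> = scl V ((- 1) ^ a) (scl V ((- 1) ^ q) \<dots>)"
        by (simp add: q power_add)
      also have "scl V ((- 1) ^ q) (wdg (scl V) a \<alpha> (\<lambda>xs. s (m - int q) (\<xi> q xs)) xs) = wdg (scl V) a \<alpha> (S m \<xi> q) xs"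
        unfolding S_def by (rule R.wdg_comp[OF sc R.subspace_UNIV]) simp
      finally show ?thesis
        using True by (simp add: wedgeO_wdg[OF A OmegaV_S[OF O]] q)
    qed (simp add: S_def wedgeO_def)
  qed
qed

text \<open>Additivity comes from \<open>P_eq\<close>, linearity over scalar forms from the explicit
  formula: \<open>proj\<close> acts on coefficients only, and the sign \<open>(- 1) ^ a\<close> from
  \<open>insD_wdg\<close> turns the sign for \<open>p = a + q\<close> into the one for
  \<open>q\<close>.\<close>

lemma P_linear: "omega_linear sG V V 0 P"
  unfolding omega_linear_def
proof (intro conjI allI impI)
  fix m \<xi> assume O: "Om m \<xi>"
  show "Om (m - int 0) (P m \<xi>)" using OmegaV_P[OF O] by simp
  fix \<eta> assume O': "Om m \<eta>"
  show "P m (\<lambda>p xs. \<xi> p xs + \<eta> p xs) = (\<lambda>p xs. P m \<xi> p xs + P m \<eta> p xs)"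
    unfolding P_eq[OF O] P_eq[OF O'] P_eq[OF OmegaV_add[OF O O']] S_add[OF O O'] dtot_add[OF O O']
      dtot_add[OF OmegaV_S[OF O] OmegaV_S[OF O']] S_add[OF OmegaV_dtot[OF O] OmegaV_dtot[OF O']]
    by (intro ext) simp
next
  fix m a \<alpha> \<xi> assume A: "altform sG (*) a UNIV (\<alpha> :: 'g list \<Rightarrow> 'k)" and O: "Om m \<xi>"
  show "P (m + int a) (wedgeO (scl V) a \<alpha> \<xi>) =
    (\<lambda>p xs. scl V ((- 1) ^ (0 * a)) (wedgeO (scl V) a \<alpha> (P m \<xi>) p xs))"
  proof (intro ext)
    fix p xs
    have p0: "proj i 0 = 0" for i
      by (rule linear_subD(4)[OF proj_linear]) simp
    show "P (m + int a) (wedgeO (scl V) a \<alpha> \<xi>) p xs = scl V ((- 1) ^ (0 * a)) (wedgeO (scl V) a \<alpha> (P m \<xi>) p xs)"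
    proof (cases "a \<le> p")
      case True
      then obtain q where q: "p = a + q" by (auto simp: le_iff_add)
      have i: "m + int a - int p = m - int q" "m + int a + 1 - int p = m + 1 - int q" by (simp_all add: q)
      \<comment> \<open>At the boundary \<open>q = 0\<close> both sides vanish: a product with an
        \<open>a\<close>-form has no component in form degree \<open>a - 1\<close>, and
        \<open>prev \<xi> 0\<close> is zero by default.\<close>
      have "prev (wedgeO (scl V) a \<alpha> \<xi>) p = wdg (scl V) a \<alpha> (prev \<xi> q)"
      proof (cases q)
        case 0
        then show ?thesis by (cases p) (auto simp: q wedgeO_def fun_eq_iff)
      next
        case (Suc r)
        then show ?thesis by (auto simp: q wedgeO_wdg[OF A O] fun_eq_iff)
      qed
      moreover have "insD (comm (m + 1 - int q)) (wdg (scl V) a \<alpha> (prev \<xi> q)) xs =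
        scl V ((- 1) ^ a) (wdg (scl V) a \<alpha> (insD (comm (m + 1 - int q)) (prev \<xi> q)) xs)"
        by (rule insD_wdg[OF comm_linear R.vector_space_axioms R.subspace_M A]) (rule OmegaV_prev_mem[OF O])
      moreover have "proj (m - int q) (wdg (scl V) a \<alpha> (\<xi> q) xs) = wdg (scl V) a \<alpha> (\<lambda>xs. proj (m - int q) (\<xi> q xs)) xs"
        by (rule R.wdg_comp[OF proj_linear R.subspace_M]) (rule OmegaV_mem[OF O])
      ultimately have "P (m + int a) (wedgeO (scl V) a \<alpha> \<xi>) p xs =
        wdg (scl V) a \<alpha> (\<lambda>xs. proj (m - int q) (\<xi> q xs)) xs +
        scl V ((- 1) ^ q) (wdg (scl V) a \<alpha> (insD (comm (m + 1 - int q)) (prev \<xi> q)) xs)"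
        using wedgeO_wdg[OF A O True] by (simp only: P_def i) (simp add: q power_add ac_simps)
      also have "scl V ((- 1) ^ q) (wdg (scl V) a \<alpha> (insD (comm (m + 1 - int q)) (prev \<xi> q)) xs) =
        wdg (scl V) a \<alpha> (\<lambda>xs. scl V ((- 1) ^ q) (insD (comm (m + 1 - int q)) (prev \<xi> q) xs)) xs"
        by (rule R.wdg_comp[of "scl V" UNIV UNIV])
          (simp_all add: linear_sub_def R.scale_right_distrib mult.commute R.subspace_UNIV)
      also have "wdg (scl V) a \<alpha> (\<lambda>xs. proj (m - int q) (\<xi> q xs)) xs + \<dots> = wdg (scl V) a \<alpha> (P m \<xi> q) xs"
        unfolding P_def by (rule R.wdg_add_right[symmetric])
      finally show ?thesis using True by (simp add: wedgeO_wdg[OF A OmegaV_P[OF O]] q)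
    next
      case False
      then have "prev (wedgeO (scl V) a \<alpha> \<xi>) p = (\<lambda>xs. 0)" by (cases p) (auto simp: wedgeO_def)
      with False show ?thesis by (simp add: P_def wedgeO_def insD_comm_zero p0)
    qed
  qed
qed

section \<open>Iterates of the perturbed projection\<close>

primrec Q :: "nat \<Rightarrow> int \<Rightarrow> (nat \<Rightarrow> 'g list \<Rightarrow> 'v) \<Rightarrow> nat \<Rightarrow> 'g list \<Rightarrow> 'v" where
  "Q 0 m \<xi> = \<xi>"
| "Q (Suc n) m \<xi> = P m (Q n m \<xi>)"

text \<open>The telescoping homotopy between the identity and the \<open>n\<close>-th power of
  \<open>P\<close>: the sum of \<open>S\<close> composed with the lower powers.\<close>

primrec H :: "nat \<Rightarrow> int \<Rightarrow> (nat \<Rightarrow> 'g list \<Rightarrow> 'v) \<Rightarrow> nat \<Rightarrow> 'g list \<Rightarrow> 'v" where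
  "H 0 m \<xi> = (\<lambda>p xs. 0)"
| "H (Suc n) m \<xi> = (\<lambda>p xs. H n m \<xi> p xs + S m (Q n m \<xi>) p xs)"

lemma Q_linear: "omega_linear sG V V 0 (Q n)"
proof (induction n)
  case 0
  show ?case by (simp add: omega_linear_def)
next
  case (Suc n)
  from omega_linear_comp[OF Suc P_linear R.vector_space_axioms R.vector_space_axioms]
  show ?case by (simp add: omega_linear_def)
qed

lemma OmegaV_Q: "Om m \<xi> \<Longrightarrow> Om m (Q n m \<xi>)"
  using omega_linearD(1)[OF Q_linear] by simp

lemma Q_dtot: "Om m \<xi> \<Longrightarrow> Q n (m + 1) (dt m \<xi>) = dt m (Q n m \<xi>)"
  by (induction n) (simp_all add: P_dtot OmegaV_Q)

lemma H_linear: "omega_linear sG V V 1 (H n)"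
proof (induction n)
  case 0
  show ?case by (simp add: omega_linear_def OmegaV_zero wedgeO_def wedge_def fun_eq_iff)
next
  case (Suc n)
  have "omega_linear sG V V 1 (\<lambda>m \<xi>. S m (Q n m \<xi>))"
    using omega_linear_comp[OF Q_linear S_linear R.vector_space_axioms R.vector_space_axioms] by simp
  from omega_linear_add[OF Suc this dg_module_axioms] show ?case by (simp add: omega_linear_def)
qed

lemma OmegaV_H: "Om m \<xi> \<Longrightarrow> Om (m - 1) (H n m \<xi>)"
  using omega_linearD(1)[OF H_linear, of m \<xi> n] by simp

lemma Q_homotopy:
  assumes O: "Om m \<xi>"
  shows "\<xi> p xs = Q n m \<xi> p xs + dt (m - 1) (H n m \<xi>) p xs + H n (m + 1) (dt m \<xi>) p xs"
proof (induction n)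
  case 0
  have "dt (m - 1) (\<lambda>p xs. 0) p xs = 0"
    by (subst dtot_eq[OF OmegaV_zero]) (cases p; simp)
  then show ?case by simp
next
  case (Suc n)
  note O' = OmegaV_Q[OF O, of n]
  have "dt (m - 1) (H (Suc n) m \<xi>) p xs = dt (m - 1) (H n m \<xi>) p xs + dt (m - 1) (S m (Q n m \<xi>)) p xs"
    by (simp add: dtot_add[OF OmegaV_H[OF O] OmegaV_S[OF O']])
  moreover have "H (Suc n) (m + 1) (dt m \<xi>) p xs = H n (m + 1) (dt m \<xi>) p xs + S (m + 1) (dt m (Q n m \<xi>)) p xs"
    by (simp add: Q_dtot[OF O])
  moreover have "Q (Suc n) m \<xi> p xs = Q n m \<xi> p xs - dt (m - 1) (S m (Q n m \<xi>)) p xs - S (m + 1) (dt m (Q n m \<xi>)) p xs"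
    by (simp add: P_eq[OF O'])
  ultimately show ?case using Suc by (simp add: algebra_simps)
qed

text \<open>The component in form degree \<open>p\<close> has coefficients in degree
  \<open>m - int p\<close>. \<open>proj\<close> kills positive degrees and the \<open>comm\<close>
  term lowers the degree by one, so the top coefficient degree drops. Truncated subtraction stops
  the bound at 0.\<close>

lemma P_height:
  assumes O: "Om m \<xi>" and h: "\<And>p xs. int k < m - int p \<Longrightarrow> \<xi> p xs = 0" and p: "int (k - 1) < m - int p"
  shows "P m \<xi> p xs = 0"
proof -
  have "proj (m - int p) (\<xi> p xs) = 0"
    by (rule proj_nonzero) (use p OmegaV_mem[OF O] in auto)
  moreover have "prev \<xi> p = (\<lambda>xs. 0)"
  proof (cases p)
    case (Suc q)
    have "\<xi> q xs = 0" for xs by (rule h) (use p Suc in auto)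
    with Suc show ?thesis by auto
  qed simp
  ultimately show ?thesis by (simp add: P_def insD_comm_zero)
qed

lemma Q_height:
  assumes O: "Om m \<xi>" and b: "\<And>i. int k < i \<Longrightarrow> carr V i = {0}"
  shows "int (k - n) < m - int p \<Longrightarrow> Q n m \<xi> p xs = 0"
proof (induction n arbitrary: p xs)
  case 0
  then show ?case using OmegaV_mem[OF O, of p xs] b by simp
next
  case (Suc n)
  show ?case unfolding Q.simps
    by (rule P_height[OF OmegaV_Q[OF O], of "k - n"]) (use Suc in auto)
qed

text \<open>After \<open>k\<close> applications only coefficient degree 0 can survive. In one more
  application the \<open>comm\<close> term would start from degree 1, where nothing is left, so only
  \<open>proj 0\<close> acts and its values lie in the kernel.\<close>

lemma Q_kerd0:
  assumes O: "Om m \<xi>" and b: "\<And>i. int k < i \<Longrightarrow> carr V i = {0}"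
  shows "Q (Suc k) m \<xi> p xs \<in> kerd0 V" "m \<noteq> int p \<Longrightarrow> Q (Suc k) m \<xi> p xs = 0"
proof -
  have h: "0 < m - int p \<Longrightarrow> Q k m \<xi> p xs = 0" for p xs
    using Q_height[OF O b, where n = k and p = p and xs = xs] by simp
  note O' = OmegaV_Q[OF O, of k]
  have z: "Q (Suc k) m \<xi> p xs = 0" if "m \<noteq> int p" for p xs
  proof (cases "m < int p")
    case True
    then show ?thesis using OmegaV_mem[OF OmegaV_Q[OF O, of "Suc k"], of p xs] carr_neg by auto
  next
    case False
    then show ?thesis using P_height[OF O', of 0 p xs] h that by simp
  qed
  then show "m \<noteq> int p \<Longrightarrow> Q (Suc k) m \<xi> p xs = 0" .
  show "Q (Suc k) m \<xi> p xs \<in> kerd0 V"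
  proof (cases "m = int p")
    case False
    then show ?thesis using z by (simp add: kerd0_def)
  next
    case True
    have "prev (Q k m \<xi>) p = (\<lambda>xs. 0)"
      using h True by (cases p) auto
    then have "Q (Suc k) m \<xi> p xs = proj 0 (Q k m \<xi> p xs)"
      using True by (simp add: P_def insD_comm_zero)
    then show ?thesis using proj_0_kerd0 OmegaV_mem[OF O', of p xs] True by simp
  qed
qed

lemma OmegaV_degree_0: "Om 0 \<xi> \<Longrightarrow> \<xi> = incl0 (\<xi> 0 [])"
proof (intro ext)
  fix p xs assume O: "Om 0 \<xi>"
  show "\<xi> p xs = incl0 (\<xi> 0 []) p xs"
  proof (cases "p = 0")
    case True
    then show ?thesis using altformD(2)[OF OmegaV_altform[OF O, of 0], of xs] by (simp add: incl0_def)
  next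
    case False
    then show ?thesis using carr_neg[OF OmegaV_mem[OF O, of p xs]] by (simp add: incl0_def)
  qed
qed

lemma OmegaV_incl0: "v \<in> carr V 0 \<Longrightarrow> Om 0 (incl0 v)"
  unfolding OmegaV_def
proof
  fix p assume "v \<in> carr V 0"
  then show "altform sG (scl V) p (carr V (0 - int p)) (incl0 v p)"
    by (cases p) (auto simp: incl0_def altform_0_iff R.altform_zero)
qed

text \<open>Form degree 0 receives no \<open>comm\<close> term, and \<open>proj 0\<close> fixes the
  kernel. Hence composing with \<open>Q\<close> does not alter values prescribed on
  \<open>kerd0 V\<close>.\<close>

lemma Q_incl0:
  assumes "v \<in> kerd0 V"
  shows "Q n 0 (incl0 v) = incl0 v"
proof (induction n)
  case (Suc n)
  have v: "v \<in> carr V 0" using assms by (simp add: kerd0_def)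
  have "P 0 (incl0 v) 0 [] = v"
    by (simp add: P_def incl0_def proj_0_id assms)
  with Suc show ?case
    using OmegaV_degree_0[OF OmegaV_P[OF OmegaV_incl0[OF v]]] by simp
qed simp

end

section \<open>A linear contraction of a resolution\<close>

lemma contraction_exists:
  fixes sG :: "'k::field_char_0 \<Rightarrow> 'g::ab_group_add \<Rightarrow> 'g"
  assumes "dg_module sG br V" "nonneg V" "resolution V"
  obtains s where "contracted sG br V s"
proof -
  interpret dg_module sG br V by fact
  define Z where "Z i = {v \<in> carr V i. d i v = 0}" for i
  have Z: "R.subspace (Z i)" for i
    by (rule R.subspaceI) (auto simp: Z_def dif_add dif_scale)
  have "\<forall>i. \<exists>\<sigma>. 1 \<le> i \<longrightarrow>
      linear_sub (scl V) (scl V) UNIV (carr V (i - 1)) \<sigma> \<and> (\<forall>z\<in>Z i. d (i - 1) (\<sigma> z) = z)"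
  proof (intro allI)
    fix i
    show "\<exists>\<sigma>. 1 \<le> i \<longrightarrow>
      linear_sub (scl V) (scl V) UNIV (carr V (i - 1)) \<sigma> \<and> (\<forall>z\<in>Z i. d (i - 1) (\<sigma> z) = z)"
    proof (cases "1 \<le> i")
      case True
      have sur: "\<exists>u\<in>carr V (i - 1). d (i - 1) u = z" if "z \<in> Z i" for z
        using \<open>resolution V\<close> that True by (auto simp: resolution_def Z_def)
      obtain \<sigma> where "linear_sub (scl V) (scl V) UNIV (carr V (i - 1)) \<sigma>" "\<And>z. z \<in> Z i \<Longrightarrow> d (i - 1) (\<sigma> z) = z"
        by (rule linear_section_exists[OF R.vector_space_axioms R.subspace_M[of "i - 1"] Z[of i] dif_linear[of "i - 1"]])
          (use sur in blast)+
      then show ?thesis by blast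
    qed simp
  qed
  then obtain \<sigma> where \<sigma>': "\<forall>i. 1 \<le> i \<longrightarrow>
      linear_sub (scl V) (scl V) UNIV (carr V (i - 1)) (\<sigma> i) \<and> (\<forall>z\<in>Z i. d (i - 1) (\<sigma> i z) = z)"
    by (rule choice[THEN exE])
  then have \<sigma>: "1 \<le> i \<Longrightarrow> linear_sub (scl V) (scl V) UNIV (carr V (i - 1)) (\<sigma> i)"
    "1 \<le> i \<Longrightarrow> z \<in> Z i \<Longrightarrow> d (i - 1) (\<sigma> i z) = z" for i z
    by blast+
  \<comment> \<open>Here \<open>\<sigma> i\<close> is a section of the differential over the
    cocycles of degree \<open>i\<close>. Subtracting \<open>\<sigma> (i + 1) (d i v)\<close> turns
    \<open>v\<close> into a cocycle, to which \<open>\<sigma> i\<close> applies; on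
    \<open>d i v\<close> itself the correction is zero.\<close>
  define s where "s i v = (if 1 \<le> i then \<sigma> i (v - \<sigma> (i + 1) (d i v)) else 0)" for i v
  have "contracted sG br V s"
  proof
    show "nonneg V" by fact
    show "linear_sub (scl V) (scl V) (carr V i) (carr V (i - 1)) (s i)" for i
    proof (cases "1 \<le> i")
      case True
      note l = \<sigma>(1)[OF True] and l' = \<sigma>(1)[of "i + 1"]
      show ?thesis unfolding linear_sub_def
      proof (intro conjI ballI allI)
        fix v w c assume v: "v \<in> carr V i"
        show "s i v \<in> carr V (i - 1)" using True linear_subD(1)[OF l] by (simp add: s_def)
        show "s i (scl V c v) = scl V c (s i v)"
          using True linear_subD(3)[OF l'] linear_subD(3)[OF l, of "v - \<sigma> (i + 1) (d i v)" c] v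
          by (simp add: s_def dif_scale R.scale_right_diff_distrib)
        assume w: "w \<in> carr V i"
        show "s i (v + w) = s i v + s i w"
          using True linear_subD(2)[OF l'] v w
            linear_subD(2)[OF l, of "v - \<sigma> (i + 1) (d i v)" "w - \<sigma> (i + 1) (d i w)"]
          by (simp add: s_def dif_add algebra_simps)
      qed
    next
      case False
      then show ?thesis by (simp add: linear_sub_def s_def)
    qed
    show "d (i - 1) (s i v) + s (i + 1) (d i v) = v" if "1 \<le> i" "v \<in> carr V i" for i v
    proof -
      let ?u = "\<sigma> (i + 1) (d i v)"
      have dv: "d i v \<in> Z (i + 1)" using that dif_dif by (simp add: Z_def)
      have u: "?u \<in> carr V i" "d i ?u = d i v"
        using linear_subD(1)[OF \<sigma>(1), of "i + 1" "d i v"] \<sigma>(2)[OF _ dv] that by auto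
      then have "v - ?u \<in> Z i" using that by (simp add: Z_def dif_diff)
      then have "d (i - 1) (s i v) = v - ?u" using \<sigma>(2) that by (simp add: s_def)
      moreover have "\<sigma> (i + 2) 0 = 0" using linear_subD(4)[OF \<sigma>(1), of "i + 2"] that by simp
      then have "s (i + 1) (d i v) = ?u" using that dif_dif[OF that(2)] by (simp add: s_def add.commute)
      ultimately show ?thesis by simp
    qed
  qed
  then show ?thesis by (rule that)
qed

lemma (in dg_module) bounded_above:
  obtains k where "\<And>i. int k < i \<Longrightarrow> carr V i = {0}"
proof -
  obtain N where N: "\<And>i. N < \<bar>i\<bar> \<Longrightarrow> carr V i = {0}" using dg by (auto simp: is_dgmod_def)
  have "carr V i = {0}" if "int (nat N) < i" for i by (rule N) (use that in linarith)
  then show ?thesis by (rule that)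
qed

section \<open>Existence and uniqueness of lifts\<close>

lemma omega_linear_zero:
  assumes "omega_linear sG V W k f" "dg_module sG br V"
  shows "f m (\<lambda>p xs. 0) = (\<lambda>p xs. 0)"
proof -
  interpret dg_module sG br V by fact
  have "f m (\<lambda>p xs. 0) = (\<lambda>p xs. f m (\<lambda>p xs. 0) p xs + f m (\<lambda>p xs. 0) p xs)"
    using omega_linearD(2)[OF assms(1) OmegaV_zero OmegaV_zero, of m] by simp
  then show ?thesis by (auto simp: fun_eq_iff)
qed

lemma omega_linear_sum:
  assumes f: "omega_linear sG V W k f" and V: "dg_module sG br V" and "finite B"
    and "\<And>b. b \<in> B \<Longrightarrow> OmegaV sG V m (\<xi> b)"
  shows "OmegaV sG V m (\<lambda>p xs. \<Sum>b\<in>B. \<xi> b p xs) \<and>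
    f m (\<lambda>p xs. \<Sum>b\<in>B. \<xi> b p xs) = (\<lambda>p xs. \<Sum>b\<in>B. f m (\<xi> b) p xs)"
  using assms(3,4)
proof (induction B)
  case empty
  show ?case using omega_linear_zero[OF f V] dg_module.OmegaV_zero[OF V] by simp
next
  case (insert b B)
  then show ?case
    using dg_module.OmegaV_add[OF V, of m "\<xi> b" "\<lambda>p xs. \<Sum>b\<in>B. \<xi> b p xs"]
      omega_linearD(2)[OF f, of m "\<xi> b" "\<lambda>p xs. \<Sum>b\<in>B. \<xi> b p xs"] by simp
qed

text \<open>The second factor has form degree 0, so its contractions vanish and every argument goes
  to \<open>\<alpha>\<close>.\<close>

lemma wdg_scalar:
  fixes sV :: "'k::field_char_0 \<Rightarrow> 'v::ab_group_add \<Rightarrow> 'v"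
  assumes "vector_space sV" "altform sG (*) a UNIV \<alpha>"
  shows "wdg sV a \<alpha> (\<lambda>xs. if xs = [] then v else 0) xs = sV (\<alpha> xs) v"
  using assms(2)
proof (induction xs arbitrary: a \<alpha>)
  case Nil
  then show ?case by simp
next
  case (Cons x xs)
  interpret vector_space sV by fact
  show ?case
  proof (cases a)
    case 0
    then have "(\<lambda>ys. \<alpha> (x # ys)) = (\<lambda>ys. 0)" using altform_0_Cons Cons.prems by blast
    then show ?thesis by (simp add: fun_eq_iff)
  next
    case (Suc b)
    then have "altform sG (*) b UNIV (\<lambda>ys. \<alpha> (x # ys))" using altform_Cons Cons.prems by blast
    with Suc Cons.IH show ?thesis by simp
  qed
qed

text \<open>Such a \<open>\<zeta>\<close> lives in the single form degree \<open>p\<close> with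
  \<open>m = int p\<close>. By \<open>altform_decompose\<close> it is a finite sum of scalar forms
  times elements \<open>incl0 b\<close> with \<open>b\<close> in the kernel, where the two maps
  agree.\<close>

lemma omega_linear_kerd0_eq:
  assumes V: "contracted sG br V s"
    and f: "omega_linear sG V W 0 f" and g: "omega_linear sG V W 0 g"
    and eq: "\<And>v. v \<in> kerd0 V \<Longrightarrow> f 0 (incl0 v) = g 0 (incl0 v)"
    and O: "OmegaV sG V m \<zeta>" and ker: "\<And>p xs. \<zeta> p xs \<in> kerd0 V"
    and conc: "\<And>p xs. m \<noteq> int p \<Longrightarrow> \<zeta> p xs = 0"
  shows "f m \<zeta> = g m \<zeta>"
proof -
  interpret contracted sG br V s by fact
  show ?thesis
  proof (cases "\<exists>p. m = int p")
    case False
    then have "\<zeta> = (\<lambda>p xs. 0)" using conc by (intro ext) auto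
    then show ?thesis using omega_linear_zero[OF f dg_module_axioms] omega_linear_zero[OF g dg_module_axioms] by simp
  next
    case True
    then obtain p where m: "m = int p" by blast
    have A: "altform sG (scl V) p (kerd0 V) (\<zeta> p)"
      using OmegaV_altform[OF O, of p] ker by (simp add: altform_def)
    obtain B c where B: "finite B" "B \<subseteq> kerd0 V" "\<And>b. b \<in> B \<Longrightarrow> altform sG (*) p UNIV (c b)"
      "\<And>xs. \<zeta> p xs = (\<Sum>b\<in>B. scl V (c b xs) b)"
      using altform_decompose[OF lie R.vector_space_axioms A] by metis
    define X where "X b = wedgeO (scl V) p (c b) (incl0 b)" for b
    have I: "Om 0 (incl0 b)" if "b \<in> B" for b
      using OmegaV_incl0[of b] that B(2) by (auto simp: kerd0_def)
    have X: "X b = (\<lambda>q xs. if q = p then scl V (c b xs) b else 0)" if b: "b \<in> B" for b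
    proof (intro ext)
      fix q xs
      show "X b q xs = (if q = p then scl V (c b xs) b else 0)"
      proof (cases "p \<le> q")
        case True
        then have X: "X b q xs = wdg (scl V) p (c b) (incl0 b (q - p)) xs"
          using wedgeO_wdg[OF B(3)[OF b] I[OF b] True] by (simp add: X_def)
        have i: "incl0 b (q - p) = (\<lambda>xs. if xs = [] then if q = p then b else 0 else 0)"
          using True by (auto simp: incl0_def)
        show ?thesis
          unfolding X i wdg_scalar[OF R.vector_space_axioms B(3)[OF b]] by simp
      qed (auto simp: X_def wedgeO_def)
    qed
    have OX: "Om m (X b)" if b: "b \<in> B" for b
      unfolding OmegaV_def
    proof
      fix q
      have "b \<in> carr V 0" using b B(2) by (auto simp: kerd0_def)
      then show "altform sG (scl V) q (carr V (m - int q)) (X b q)"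
        using B(3)[OF b]
        by (cases "q = p") (auto simp: X[OF b] m R.altform_zero altform_def R.scale_left_distrib)
    qed
    have \<zeta>: "\<zeta> = (\<lambda>q xs. \<Sum>b\<in>B. X b q xs)"
    proof (intro ext)
      fix q xs
      show "\<zeta> q xs = (\<Sum>b\<in>B. X b q xs)"
        using conc[of q xs] m by (cases "q = p") (simp_all add: X B(4))
    qed
    have "f m (X b) = g m (X b)" if b: "b \<in> B" for b
    proof -
      have "f 0 (incl0 b) = g 0 (incl0 b)" using eq b B(2) by blast
      then show ?thesis
        using omega_linearD(3)[OF f B(3)[OF b] I[OF b]] omega_linearD(3)[OF g B(3)[OF b] I[OF b]]
        by (simp add: X_def m)
    qed
    then show ?thesis
      using omega_linear_sum[OF f dg_module_axioms B(1) OX] omega_linear_sum[OF g dg_module_axioms B(1) OX]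
      unfolding \<zeta> by simp
  qed
qed

text \<open>The difference \<open>D\<close> is a chain map that vanishes on the image of
  \<open>Q\<close>, so applying it to \<open>Q_homotopy\<close> writes \<open>D\<close> as the
  boundary of \<open>D\<close> composed with \<open>H\<close>. That composite is the
  homotopy.\<close>

lemma lift_unique:
  assumes V: "contracted sG br V s" and W: "dg_module sG br W" and nW: "nonneg W"
    and f: "weak_morph sG br V W f" and g: "weak_morph sG br V W g"
    and eq: "\<And>v. v \<in> kerd0 V \<Longrightarrow> f00 f v = f00 g v"
  shows "homotopic sG br V W f g"
proof -
  interpret contracted sG br V s by fact
  interpret W: dg_module sG br W by fact
  obtain k where k: "\<And>i. int k < i \<Longrightarrow> carr V i = {0}" using bounded_above by blast
  let ?Q = "Q (Suc k)" and ?H = "H (Suc k)"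
  define D where "D = (\<lambda>m \<xi> p xs. g m \<xi> p xs - f m \<xi> p xs)"
  have fl: "omega_linear sG V W 0 f" and gl: "omega_linear sG V W 0 g"
    and fd: "OmegaV sG V m \<xi> \<Longrightarrow> f (m + 1) (dt m \<xi>) = W.dt m (f m \<xi>)"
    and gd: "OmegaV sG V m \<xi> \<Longrightarrow> g (m + 1) (dt m \<xi>) = W.dt m (g m \<xi>)" for m \<xi>
    using f g by (auto simp: weak_morph_iff[OF W])
  have Dl: "omega_linear sG V W 0 D"
    unfolding D_def by (rule omega_linear_diff[OF gl fl W])
  \<comment> \<open>Since \<open>W\<close> is non-negative, an element of total degree 0 has only
    its component in form degree 0, so \<open>f00\<close> determines the whole value.\<close>
  have inc: "f' 0 (incl0 v) = incl0 (f00 f' v)" if l: "omega_linear sG V W 0 f'" and v: "v \<in> kerd0 V" for f' v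
  proof -
    have "Om 0 (incl0 v)" using OmegaV_incl0 v by (simp add: kerd0_def)
    from omega_linearD(1)[OF l this] have O: "W.Om 0 (f' 0 (incl0 v))" by simp
    show ?thesis
    proof (intro ext)
      fix p xs
      show "f' 0 (incl0 v) p xs = incl0 (f00 f' v) p xs"
        using altformD(2)[OF W.OmegaV_altform[OF O, of 0], of xs] W.OmegaV_mem[OF O, of p xs] nW
        by (cases "p = 0") (auto simp: incl0_def f00_def nonneg_def)
    qed
  qed
  have D0: "D m (?Q m \<xi>) p xs = 0" if O: "Om m \<xi>" for m \<xi> p xs
  proof -
    have "f m (?Q m \<xi>) = g m (?Q m \<xi>)"
      by (rule omega_linear_kerd0_eq[OF V fl gl _ OmegaV_Q[OF O] Q_kerd0[OF O k]])
        (use inc[OF fl] inc[OF gl] eq in auto)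
    then show ?thesis by (simp add: D_def)
  qed
  have h: "omega_linear sG V W 1 (\<lambda>m \<xi>. D (m - 1) (?H m \<xi>))"
    using omega_linear_comp[OF H_linear Dl R.vector_space_axioms W.R.vector_space_axioms, of "Suc k"]
    by (simp del: H.simps)
  have "D m \<xi> p xs = W.dt (m - 1) (D (m - 1) (?H m \<xi>)) p xs + D m (?H (m + 1) (dt m \<xi>)) p xs"
    if O: "Om m \<xi>" for m \<xi> p xs
  proof -
    note OH = OmegaV_H[OF O, of "Suc k"]
    have Od: "Om m (dt (m - 1) (?H m \<xi>))" using OmegaV_dtot[OF OH] by simp
    have OHd: "Om m (?H (m + 1) (dt m \<xi>))" using OmegaV_H[OF OmegaV_dtot[OF O], of "Suc k"] by simp
    note OQ = OmegaV_Q[OF O, of "Suc k"]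
    have "\<xi> = (\<lambda>p xs. ?Q m \<xi> p xs + dt (m - 1) (?H m \<xi>) p xs + ?H (m + 1) (dt m \<xi>) p xs)"
      by (intro ext) (rule Q_homotopy[OF O])
    then have "D m \<xi> p xs = D m (\<lambda>p xs. ?Q m \<xi> p xs + dt (m - 1) (?H m \<xi>) p xs + ?H (m + 1) (dt m \<xi>) p xs) p xs"
      by (rule arg_cong)
    also have "\<dots> = D m (?Q m \<xi>) p xs + D m (dt (m - 1) (?H m \<xi>)) p xs + D m (?H (m + 1) (dt m \<xi>)) p xs"
      unfolding omega_linearD(2)[OF Dl OmegaV_add[OF OQ Od] OHd] omega_linearD(2)[OF Dl OQ Od] ..
    also have "D m (?Q m \<xi>) p xs = 0" by (rule D0[OF O])
    also have "D m (dt (m - 1) (?H m \<xi>)) = W.dt (m - 1) (D (m - 1) (?H m \<xi>))"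
      using fd[OF OH] gd[OF OH] W.dtot_diff[OF omega_linearD(1)[OF gl OH] omega_linearD(1)[OF fl OH]]
      by (simp add: D_def)
    finally show ?thesis by simp
  qed
  then show ?thesis
    using h unfolding homotopic_def omega_linear_def
    by (intro exI[of _ "\<lambda>m \<xi>. D (m - 1) (?H m \<xi>)"]) (simp add: D_def fun_eq_iff)
qed

text \<open>The lift is \<open>u\<close> after \<open>Q\<close>. It makes sense because
  \<open>Q\<close> takes values in the kernel; there the internal differentials vanish on both
  sides, and equivariance of \<open>u\<close> gives compatibility with \<open>CE\<close>.\<close>

lemma lift_exists:
  assumes V: "contracted sG br V s" and W: "dg_module sG br W"
    and u: "linear_sub (scl V) (scl W) (kerd0 V) (kerd0 W) u"
    and equiv: "\<And>x v. v \<in> kerd0 V \<Longrightarrow> u (act V x v) = act W x (u v)"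
  obtains f where "weak_morph sG br V W f" "\<And>v. v \<in> kerd0 V \<Longrightarrow> f00 f v = u v"
proof -
  interpret contracted sG br V s by fact
  interpret W: dg_module sG br W by fact
  obtain k where k: "\<And>i. int k < i \<Longrightarrow> carr V i = {0}" using bounded_above by blast
  let ?Q = "Q (Suc k)"
  note Qk = Q_kerd0[OF _ k]
  have sub: "R.subspace (kerd0 V)"
    by (rule R.subspaceI) (auto simp: kerd0_def dif_add dif_scale)
  have equivd: "d 0 (act V x v) = act V x (d 0 v)" if "v \<in> carr V 0" for x v
    using dg that by (simp add: is_dgmod_def)
  have act0: "act V x v \<in> kerd0 V" if "v \<in> kerd0 V" for x v
    using that R.rho_M[of v 0 x] equivd[of v x] by (simp add: kerd0_def)
  have "gmod sG br (scl V) (act V) (carr V 0)" using R.rep .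
  then have "gmod sG br (scl V) (act V) (kerd0 V)"
    using sub act0 unfolding gmod_def by (auto simp: kerd0_def)
  \<comment> \<open>The kernel is a subrepresentation, so \<open>CE_comp\<close> applies to
    \<open>u\<close>, for which linearity and equivariance are known only there.\<close>
  then have repE: "lie_rep sG br (scl V) (act V) (kerd0 V)"
    using lie by (simp add: lie_rep_def)
  have u0: "u 0 = 0" by (rule linear_subD(4)[OF u]) (rule R.subspace_0[OF sub])
  have CEu: "W.CE (\<lambda>xs. u (\<omega> xs)) xs = u (CE \<omega> xs)" if "\<And>xs. \<omega> xs \<in> kerd0 V" for \<omega> xs
  proof -
    have "insD (\<lambda>x v. act W x (u v) - u (act V x v)) \<omega> xs = 0"
      by (rule insD_eq_zero[of "kerd0 V"]) (use equiv that in auto)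
    moreover have "W.CE (\<lambda>xs. u (\<omega> xs)) xs = u (CE \<omega> xs) + insD (\<lambda>x v. act W x (u v) - u (act V x v)) \<omega> xs"
      by (rule CE_comp[OF repE W.lie_rep[of 0]])
        (use linear_subD(1)[OF u] linear_sub_diff[OF u R.vector_space_axioms sub] that in \<open>auto simp: kerd0_def\<close>)
    ultimately show ?thesis by simp
  qed
  define f where "f = (\<lambda>m \<xi> p xs. u (?Q m \<xi> p xs))"
  have Of: "W.Om m (f m \<xi>)" if O: "Om m \<xi>" for m \<xi>
    unfolding OmegaV_def
  proof
    fix p
    have A: "altform sG (scl V) p (kerd0 V) (?Q m \<xi> p)"
      using OmegaV_altform[OF OmegaV_Q[OF O], of p] Qk(1)[OF O] unfolding altform_def by blast
    show "altform sG (scl W) p (carr W (m - int p)) (f m \<xi> p)"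
    proof (cases "m = int p")
      case True
      have "linear_sub (scl V) (scl W) (kerd0 V) (carr W 0) u"
        using u by (auto simp: linear_sub_def kerd0_def)
      from altform_comp[OF this R.subspace_0[OF sub] A] True show ?thesis by (simp add: f_def)
    next
      case False
      then have "f m \<xi> p = (\<lambda>xs. 0)" using Qk(2)[OF O] by (simp add: f_def u0 fun_eq_iff)
      then show ?thesis by (simp add: W.R.altform_zero)
    qed
  qed
  have fl: "omega_linear sG V W 0 f"
    unfolding omega_linear_def
  proof (intro conjI allI impI)
    fix m \<xi> assume O: "Om m \<xi>"
    show "W.Om (m - int 0) (f m \<xi>)" using Of[OF O] by simp
    fix \<eta> assume O': "Om m \<eta>"
    show "f m (\<lambda>p xs. \<xi> p xs + \<eta> p xs) = (\<lambda>p xs. f m \<xi> p xs + f m \<eta> p xs)"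
      unfolding f_def omega_linearD(2)[OF Q_linear O O']
      by (intro ext linear_subD(2)[OF u] Qk(1) O O')
  next
    fix m a \<alpha> \<xi> assume A: "altform sG (*) a UNIV (\<alpha> :: 'b list \<Rightarrow> 'a)" and O: "Om m \<xi>"
    show "f (m + int a) (wedgeO (scl V) a \<alpha> \<xi>) =
      (\<lambda>p xs. scl W ((- 1) ^ (0 * a)) (wedgeO (scl W) a \<alpha> (f m \<xi>) p xs))"
    proof (intro ext)
      fix p xs
      have "f (m + int a) (wedgeO (scl V) a \<alpha> \<xi>) p xs = u (wedgeO (scl V) a \<alpha> (?Q m \<xi>) p xs)"
        using omega_linearD(3)[OF Q_linear A O, of "Suc k"] by (simp add: f_def del: Q.simps)
      also have "\<dots> = wedgeO (scl W) a \<alpha> (f m \<xi>) p xs"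
      proof (cases "a \<le> p")
        case True
        have "u (wdg (scl V) a \<alpha> (?Q m \<xi> (p - a)) xs) = wdg (scl W) a \<alpha> (f m \<xi> (p - a)) xs"
          unfolding f_def by (rule R.wdg_comp[OF u sub]) (rule Qk(1)[OF O])
        then show ?thesis
          using wedgeO_wdg[OF A OmegaV_Q[OF O] True]
            wedge_eq_wdg[OF W.R.vector_space_axioms A W.OmegaV_altform[OF Of[OF O]]] True
          by (simp add: wedgeO_def[of "scl W"] del: Q.simps)
      qed (simp add: wedgeO_def u0)
      finally show "f (m + int a) (wedgeO (scl V) a \<alpha> \<xi>) p xs =
        scl W ((- 1) ^ (0 * a)) (wedgeO (scl W) a \<alpha> (f m \<xi>) p xs)" by simp
    qed
  qed
  have fd: "f (m + 1) (dt m \<xi>) = W.dt m (f m \<xi>)" if O: "Om m \<xi>" for m \<xi>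
  proof (intro ext)
    fix p xs
    note OQ = OmegaV_Q[OF O, of "Suc k"]
    \<comment> \<open>For \<open>m = int p\<close> the value is a cocycle of degree 0; in every
      other form degree it is zero.\<close>
    have kz: "d (m - int p) (?Q m \<xi> p xs) = 0"
      using Qk[OF O, where p = p and xs = xs] by (cases "m = int p") (auto simp: kerd0_def simp del: Q.simps)
    have kw: "W.d (m - int p) (f m \<xi> p xs) = 0"
      using Qk[OF O, where p = p and xs = xs] linear_subD(1)[OF u, of "?Q m \<xi> p xs"] u0
      by (cases "m = int p") (auto simp: kerd0_def f_def simp del: Q.simps)
    have pk: "prev (?Q m \<xi>) p xs \<in> kerd0 V" for xs
      using Qk(1)[OF O] R.subspace_0[OF sub] by (cases p) (auto simp del: Q.simps)
    have pf: "prev (f m \<xi>) p = (\<lambda>xs. u (prev (?Q m \<xi>) p xs))"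
      by (cases p) (auto simp: f_def u0)
    have "f (m + 1) (dt m \<xi>) p xs = u (dt m (?Q m \<xi>) p xs)"
      by (simp add: f_def Q_dtot[OF O] del: Q.simps)
    also have "\<dots> = u (CE (prev (?Q m \<xi>) p) xs)"
      by (simp add: dtot_eq[OF OQ] kz del: Q.simps)
    also have "\<dots> = W.CE (prev (f m \<xi>) p) xs"
      unfolding pf by (rule CEu[symmetric]) (rule pk)
    also have "\<dots> = W.dt m (f m \<xi>) p xs"
      by (simp add: W.dtot_eq[OF Of[OF O]] kw)
    finally show "f (m + 1) (dt m \<xi>) p xs = W.dt m (f m \<xi>) p xs" .
  qed
  show ?thesis
  proof (rule that)
    show "weak_morph sG br V W f" using fl fd by (auto simp: weak_morph_iff[OF W])
    show "f00 f v = u v" if "v \<in> kerd0 V" for v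
      using Q_incl0[OF that, of "Suc k"] by (simp add: f00_def f_def incl0_def del: Q.simps)
  qed
qed

theorem theorem1p8:
  fixes sG :: "'k::field_char_0 \<Rightarrow> 'g::ab_group_add \<Rightarrow> 'g"
    and br :: "'g \<Rightarrow> 'g \<Rightarrow> 'g"
    and V :: "('k, 'g, 'v::ab_group_add) dgmod"
    and W :: "('k, 'g, 'w::ab_group_add) dgmod"
    and sE :: "'k \<Rightarrow> 'e::ab_group_add \<Rightarrow> 'e" and rhoE :: "'g \<Rightarrow> 'e \<Rightarrow> 'e"
    and sF :: "'k \<Rightarrow> 'f::ab_group_add \<Rightarrow> 'f" and rhoF :: "'g \<Rightarrow> 'f \<Rightarrow> 'f"
    and iE :: "'e \<Rightarrow> 'v" and iF :: "'f \<Rightarrow> 'w"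
    and phi :: "'e \<Rightarrow> 'f"
  assumes "lie_algebra sG br"
    and "is_dgmod sG br V" and "nonneg V"
    and "is_dgmod sG br W" and "nonneg W"
    and "gmod sG br sE rhoE UNIV" and "gmod sG br sF rhoF UNIV"
    and "dg_lift sG br V sE rhoE iE" and "dg_lift sG br W sF rhoF iF"
    and "resolution V"
    and "gmod_hom sE rhoE sF rhoF UNIV phi"
  shows "(\<exists>f. weak_morph sG br V W f \<and> is_dg_lift_of f iE iF phi) \<and>
         (\<forall>f f'. weak_morph sG br V W f \<and> is_dg_lift_of f iE iF phi \<and>
                 weak_morph sG br V W f' \<and> is_dg_lift_of f' iE iF phi \<longrightarrow>
                 homotopic sG br V W f f')"
proof -
  have V: "dg_module sG br V" and W: "dg_module sG br W"
    using assms by (simp_all add: dg_module_def)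
  obtain s where s: "contracted sG br V s"
    using contraction_exists[OF V \<open>nonneg V\<close> \<open>resolution V\<close>] .
  have iE: "\<And>v w. iE (v + w) = iE v + iE w" "\<And>c v. iE (sE c v) = scl V c (iE v)"
    "\<And>x v. iE (rhoE x v) = act V x (iE v)" "inj iE" "range iE = kerd0 V"
    using assms(8) by (auto simp: dg_lift_def gmod_hom_def bij_betw_def)
  have iF: "\<And>v w. iF (v + w) = iF v + iF w" "\<And>c v. iF (sF c v) = scl W c (iF v)"
    "\<And>x v. iF (rhoF x v) = act W x (iF v)" "range iF = kerd0 W"
    using assms(9) by (auto simp: dg_lift_def gmod_hom_def bij_betw_def)
  have ph: "\<And>v w. phi (v + w) = phi v + phi w" "\<And>c v. phi (sE c v) = sF c (phi v)"
    "\<And>x v. phi (rhoE x v) = rhoF x (phi v)"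
    using assms(11) by (auto simp: gmod_hom_def)
  \<comment> \<open>Transport of \<open>phi\<close> to the kernels along the identifications
    \<open>iE\<close> and \<open>iF\<close>; \<open>iE\<close> is a bijection onto
    \<open>kerd0 V\<close>, so its inverse is meaningful there.\<close>
  define u where "u v = iF (phi (inv_into UNIV iE v))" for v
  have u: "u (iE e) = iF (phi e)" for e by (simp add: u_def iE(4))
  have "linear_sub (scl V) (scl W) (kerd0 V) (kerd0 W) u"
    unfolding linear_sub_def iE(5)[symmetric] iF(4)[symmetric]
    by (auto simp: u ph iF(1,2) simp flip: iE(1,2))
  moreover have "u (act V x v) = act W x (u v)" if "v \<in> kerd0 V" for x v
    using that unfolding iE(5)[symmetric] by (auto simp: u ph iF simp flip: iE(3))
  ultimately obtain f where f: "weak_morph sG br V W f" "\<And>v. v \<in> kerd0 V \<Longrightarrow> f00 f v = u v"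
    using lift_exists[OF s W] by blast
  have k: "iE e \<in> kerd0 V" for e using iE(5) by blast
  show ?thesis
  proof (intro conjI allI impI)
    show "\<exists>f. weak_morph sG br V W f \<and> is_dg_lift_of f iE iF phi"
      using f k by (auto simp: is_dg_lift_of_def u)
    fix f f' assume "weak_morph sG br V W f \<and> is_dg_lift_of f iE iF phi \<and>
      weak_morph sG br V W f' \<and> is_dg_lift_of f' iE iF phi"
    then show "homotopic sG br V W f f'"
      by (intro lift_unique[OF s W \<open>nonneg W\<close>]) (auto simp: is_dg_lift_of_def simp flip: iE(5))
  qed
qed

end
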